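(* The Flow Diagram (FD) problem, parameterized by the number $m$ of state sequences, is $W[1]$-hard, even when the number of criteria is a constant.
   Context: A state sequence is a finite sequence of states. A criterion is a Boolean predicate evaluated on a set of contiguous subsequences (segments) taken from the input state sequences; a set of segments fulfils $C$ if $C$ evaluates to true on it. A segmentation of a state sequence $\tau$ is a partition of $\tau$ into consecutive nonempty contiguous subsequences, called segments. A flow diagram is a node-labelled directed acyclic graph with a source node $s$ and a sink node $t$, in which every other node is labelled by a criterion; its size is its number of nodes. Given state sequences $\mathcal T=\{\tau_1,\dots,\tau_m\}$ and criteria $\mathcal C=\{C_1,\dots,C_k\}$, a flow diagram $F$ is valid for $\mathcal T$ if for each $\tau_i$ there is a segmentation $(\sigma_{i,1},\dots,\sigma_{i,r_i})$ of $\tau_i$ and an $s$–$t$ path $s,v_{i,1},\dots,v_{i,r_i},t$ in $F$ such that for every node $v\neq s,t$ of $F$, the set of all segments $\sigma_{i,j}$ with $v_{i,j}=v$ jointly fulfils the criterion labelling $v$. The FD problem: given $\mathcal T$ (each sequence of length at most $n$), $\mathcal C$, and an integer $\lambda>2$, decide whether there is a valid flow diagram for $\mathcal T$ with at most $\lambda$ nodes. *)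

theory Defs
  imports Main "HOL-Library.List_Lexorder"
begin

section \<open>Model of computation\<close>

text \<open>
  Programs of Jones's WHILE language (N. D. Jones, \<^emph>\<open>Computability and Complexity from a
  Programming Perspective\<close>), whose values are binary trees.  Evaluating an expression is charged
  the sizes of all values arising from its subexpressions, rather than unit cost.  So a run of cost
  \<open>t\<close> only ever builds trees of total size at most \<open>t\<close> (in particular repeated \<open>X := cons X X\<close> is
  charged for the exponential growth), and the model is polynomially equivalent to deterministic
  multitape Turing machines.
\<close>

datatype data = Atom | Pair data data

primrec dsize :: "data \<Rightarrow> nat" where
  "dsize Atom = 1"
| "dsize (Pair a b) = 1 + dsize a + dsize b"

datatype expr = EVar nat | EConst data | ECons expr expr | EHd expr | ETl expr | EEq expr expr

datatype com = Assign nat expr | Seq com com | IfElse expr com com | While expr com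

type_synonym store = "nat \<Rightarrow> data"

fun hd_data :: "data \<Rightarrow> data" where
  "hd_data Atom = Atom"
| "hd_data (Pair a b) = a"

fun tl_data :: "data \<Rightarrow> data" where
  "tl_data Atom = Atom"
| "tl_data (Pair a b) = b"

primrec expr_val :: "store \<Rightarrow> expr \<Rightarrow> data" where
  "expr_val s (EVar x) = s x"
| "expr_val s (EConst d) = d"
| "expr_val s (ECons e f) = Pair (expr_val s e) (expr_val s f)"
| "expr_val s (EHd e) = hd_data (expr_val s e)"
| "expr_val s (ETl e) = tl_data (expr_val s e)"
| "expr_val s (EEq e f) = (if expr_val s e = expr_val s f then Pair Atom Atom else Atom)"

primrec expr_cost :: "store \<Rightarrow> expr \<Rightarrow> nat" where
  "expr_cost s (EVar x) = dsize (s x)"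
| "expr_cost s (EConst d) = dsize d"
| "expr_cost s (ECons e f) = expr_cost s e + expr_cost s f + dsize (expr_val s (ECons e f))"
| "expr_cost s (EHd e) = expr_cost s e + dsize (expr_val s (EHd e))"
| "expr_cost s (ETl e) = expr_cost s e + dsize (expr_val s (ETl e))"
| "expr_cost s (EEq e f) = expr_cost s e + expr_cost s f + dsize (expr_val s (EEq e f))"

text \<open>\<open>exec c s t s'\<close>: started in \<open>s\<close>, program \<open>c\<close> halts in \<open>s'\<close> after time \<open>t\<close>.
  \<open>Atom\<close> is false, every other value is true.\<close>

inductive exec :: "com \<Rightarrow> store \<Rightarrow> nat \<Rightarrow> store \<Rightarrow> bool" where
  Assign: "exec (Assign x e) s (1 + expr_cost s e) (s(x := expr_val s e))"
| Seq: "exec c s t s' \<Longrightarrow> exec d s' u s'' \<Longrightarrow> exec (Seq c d) s (t + u) s''"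
| IfTrue: "expr_val s e \<noteq> Atom \<Longrightarrow> exec c s t s' \<Longrightarrow>
    exec (IfElse e c d) s (1 + expr_cost s e + t) s'"
| IfFalse: "expr_val s e = Atom \<Longrightarrow> exec d s t s' \<Longrightarrow>
    exec (IfElse e c d) s (1 + expr_cost s e + t) s'"
| WhileFalse: "expr_val s e = Atom \<Longrightarrow> exec (While e c) s (1 + expr_cost s e) s"
| WhileTrue: "expr_val s e \<noteq> Atom \<Longrightarrow> exec c s t s' \<Longrightarrow> exec (While e c) s' u s'' \<Longrightarrow>
    exec (While e c) s (1 + expr_cost s e + t + u) s''"

text \<open>Variable 0 holds the input and the output; all other variables are initially \<open>Atom\<close>.\<close>

definition computes_in :: "com \<Rightarrow> data \<Rightarrow> nat \<Rightarrow> data \<Rightarrow> bool" where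
  "computes_in c x t y \<longleftrightarrow> (\<exists>s. exec c ((\<lambda>_. Atom)(0 := x)) t s \<and> s 0 = y)"


section \<open>Encodings\<close>

primrec enc_nat :: "nat \<Rightarrow> data" where  \<comment> \<open>unary\<close>
  "enc_nat 0 = Atom"
| "enc_nat (Suc n) = Pair Atom (enc_nat n)"

fun enc_bin :: "nat \<Rightarrow> data" where  \<comment> \<open>binary, least significant bit first\<close>
  "enc_bin n = (if n = 0 then Atom
     else Pair (if odd n then Pair Atom Atom else Atom) (enc_bin (n div 2)))"

declare enc_bin.simps [simp del]

primrec enc_list :: "data list \<Rightarrow> data" where
  "enc_list [] = Atom"
| "enc_list (x # xs) = Pair x (enc_list xs)"

primrec enc_expr :: "expr \<Rightarrow> data" where
  "enc_expr (EVar x) = Pair (enc_nat 0) (enc_nat x)"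
| "enc_expr (EConst d) = Pair (enc_nat 1) d"
| "enc_expr (ECons e f) = Pair (enc_nat 2) (Pair (enc_expr e) (enc_expr f))"
| "enc_expr (EHd e) = Pair (enc_nat 3) (enc_expr e)"
| "enc_expr (ETl e) = Pair (enc_nat 4) (enc_expr e)"
| "enc_expr (EEq e f) = Pair (enc_nat 5) (Pair (enc_expr e) (enc_expr f))"

primrec enc_com :: "com \<Rightarrow> data" where
  "enc_com (Assign x e) = Pair (enc_nat 0) (Pair (enc_nat x) (enc_expr e))"
| "enc_com (Seq c d) = Pair (enc_nat 1) (Pair (enc_com c) (enc_com d))"
| "enc_com (IfElse e c d) = Pair (enc_nat 2) (Pair (enc_expr e) (Pair (enc_com c) (enc_com d)))"
| "enc_com (While e c) = Pair (enc_nat 3) (Pair (enc_expr e) (enc_com c))"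

lemma enc_nat_inject [simp]: "enc_nat m = enc_nat n \<longleftrightarrow> m = n"
proof (induction m arbitrary: n)
  case 0
  then show ?case by (cases n) auto
next
  case (Suc m)
  then show ?case by (cases n) auto
qed

lemma enc_bin_inject [simp]: "enc_bin m = enc_bin n \<longleftrightarrow> m = n"
proof (induction m arbitrary: n rule: less_induct)
  case (less m)
  show ?case
  proof (cases "m = 0 \<or> n = 0")
    case True
    then show ?thesis by (auto simp: enc_bin.simps[of m] enc_bin.simps[of n])
  next
    case False
    then have "enc_bin m = enc_bin n \<longleftrightarrow> odd m = odd n \<and> m div 2 = n div 2"
      using less[of "m div 2" "n div 2"]
      by (auto simp: enc_bin.simps[of m] enc_bin.simps[of n])
    also have "\<dots> \<longleftrightarrow> m = n" by presburger
    finally show ?thesis .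
  qed
qed

lemma enc_list_inject [simp]: "enc_list xs = enc_list ys \<longleftrightarrow> xs = ys"
proof (induction xs arbitrary: ys)
  case Nil
  then show ?case by (cases ys) auto
next
  case (Cons x xs)
  then show ?case by (cases ys) auto
qed

lemma enc_expr_inject [simp]: "enc_expr e = enc_expr f \<longleftrightarrow> e = f"
  by (induction e arbitrary: f; case_tac f) (auto simp del: enc_nat.simps)

lemma enc_com_inject [simp]: "enc_com c = enc_com d \<longleftrightarrow> c = d"
  by (induction c arbitrary: d; case_tac d) (auto simp del: enc_nat.simps)


section \<open>Parameterized problems and the W-hierarchy\<close>

text \<open>An instance is a pair of an input and its parameter; trees that encode nothing are
  no-instances.\<close>

type_synonym problem = "(data \<times> nat) set"

definition computable :: "(nat \<Rightarrow> nat) \<Rightarrow> bool" where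
  "computable f \<longleftrightarrow> (\<exists>c. \<forall>n. \<exists>t. computes_in c (enc_nat n) t (enc_nat (f n)))"

definition fpt_reducible :: "problem \<Rightarrow> problem \<Rightarrow> bool"  (infix \<open>\<le>\<^sub>f\<^sub>p\<^sub>t\<close> 50) where
  "P \<le>\<^sub>f\<^sub>p\<^sub>t Q \<longleftrightarrow> (\<exists>c f g a. computable f \<and> computable g \<and>
     (\<forall>x k. \<exists>t y l. computes_in c (Pair x (enc_nat k)) t (Pair y (enc_nat l)) \<and>
        t \<le> f k * dsize x ^ a \<and> l \<le> g k \<and> ((x, k) \<in> P \<longleftrightarrow> (y, l) \<in> Q)))"

text \<open>
  A Boolean circuit is a list of gates in topological order, a gate referring to its predecessors
  by their positions; the last gate is the output.  Input gates are the variables, so that an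
  assignment is the set of positions of those input gates that are set to true.
\<close>

datatype gate = InpG | NotG nat | AndG "nat list" | OrG "nat list"

type_synonym circuit = "gate list"

primrec preds :: "gate \<Rightarrow> nat list" where
  "preds InpG = []"
| "preds (NotG j) = [j]"
| "preds (AndG js) = js"
| "preds (OrG js) = js"

primrec fan_in_ok :: "gate \<Rightarrow> bool" where
  "fan_in_ok InpG = True"
| "fan_in_ok (NotG j) = True"
| "fan_in_ok (AndG js) = (2 \<le> length js)"
| "fan_in_ok (OrG js) = (2 \<le> length js)"

definition is_circuit :: "circuit \<Rightarrow> bool" where
  "is_circuit C \<longleftrightarrow> C \<noteq> [] \<and>
     (\<forall>i < length C. fan_in_ok (C ! i) \<and> (\<forall>j \<in> set (preds (C ! i)). j < i))"

definition inputs :: "circuit \<Rightarrow> nat set" where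
  "inputs C = {i. i < length C \<and> C ! i = InpG}"

definition io_path :: "circuit \<Rightarrow> nat list \<Rightarrow> bool" where
  "io_path C p \<longleftrightarrow> p \<noteq> [] \<and> hd p \<in> inputs C \<and> last p = length C - 1 \<and>
     successively (\<lambda>i j. j < length C \<and> i \<in> set (preds (C ! j))) p"

definition depth_at_most :: "nat \<Rightarrow> circuit \<Rightarrow> bool" where
  "depth_at_most d C \<longleftrightarrow> (\<forall>p. io_path C p \<longrightarrow> length p - 1 \<le> d)"

definition large :: "gate \<Rightarrow> bool" where
  "large g \<longleftrightarrow> length (preds g) > 2"

definition weft_at_most :: "nat \<Rightarrow> circuit \<Rightarrow> bool" where
  "weft_at_most t C \<longleftrightarrow> (\<forall>p. io_path C p \<longrightarrow> length (filter (\<lambda>i. large (C ! i)) p) \<le> t)"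

text \<open>\<open>gate_val A vs g\<close> is the value of the gate \<open>g\<close> at position \<open>length vs\<close>, where \<open>vs\<close> are the
  values of the gates before it.\<close>

primrec gate_val :: "nat set \<Rightarrow> bool list \<Rightarrow> gate \<Rightarrow> bool" where
  "gate_val A vs InpG = (length vs \<in> A)"
| "gate_val A vs (NotG j) = (\<not> vs ! j)"
| "gate_val A vs (AndG js) = (\<forall>j \<in> set js. vs ! j)"
| "gate_val A vs (OrG js) = (\<exists>j \<in> set js. vs ! j)"

definition gate_vals :: "nat set \<Rightarrow> circuit \<Rightarrow> bool list" where
  "gate_vals A C = foldl (\<lambda>vs g. vs @ [gate_val A vs g]) [] C"

definition satisfies :: "nat set \<Rightarrow> circuit \<Rightarrow> bool" where
  "satisfies A C \<longleftrightarrow> last (gate_vals A C)"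

primrec enc_gate :: "gate \<Rightarrow> data" where
  "enc_gate InpG = Pair (enc_nat 0) Atom"
| "enc_gate (NotG j) = Pair (enc_nat 1) (enc_nat j)"
| "enc_gate (AndG js) = Pair (enc_nat 2) (enc_list (map enc_nat js))"
| "enc_gate (OrG js) = Pair (enc_nat 3) (enc_list (map enc_nat js))"

definition enc_circuit :: "circuit \<Rightarrow> data" where
  "enc_circuit C = enc_list (map enc_gate C)"

lemma map_enc_nat_inject [simp]: "map enc_nat xs = map enc_nat ys \<longleftrightarrow> xs = ys"
  by (simp add: inj_map_eq_map inj_def)

lemma enc_gate_inject [simp]: "enc_gate g = enc_gate h \<longleftrightarrow> g = h"
  by (cases g; cases h) (auto simp del: enc_nat.simps)

lemma enc_circuit_inject [simp]: "enc_circuit C = enc_circuit D \<longleftrightarrow> C = D"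
  by (simp add: enc_circuit_def inj_map_eq_map inj_def)

text \<open>Weighted circuit satisfiability for circuits of weft at most \<open>t\<close> and depth at most \<open>d\<close>.\<close>

definition WCS :: "nat \<Rightarrow> nat \<Rightarrow> problem" where
  "WCS t d = {(enc_circuit C, k) | C k. is_circuit C \<and> weft_at_most t C \<and> depth_at_most d C \<and>
     (\<exists>A \<subseteq> inputs C. card A = k \<and> satisfies A C)}"

definition W :: "nat \<Rightarrow> problem set" where
  "W t = {P. \<exists>d \<ge> 1. P \<le>\<^sub>f\<^sub>p\<^sub>t WCS t d}"

definition W_hard :: "nat \<Rightarrow> problem \<Rightarrow> bool" where
  "W_hard t Q \<longleftrightarrow> (\<forall>P \<in> W t. P \<le>\<^sub>f\<^sub>p\<^sub>t Q)"


section \<open>Flow diagrams\<close>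

type_synonym 'a criterion = "'a list set \<Rightarrow> bool"

record 'a flow_diagram =
  nodes :: "nat set"
  edges :: "(nat \<times> nat) set"
  source :: nat
  sink :: nat
  label :: "nat \<Rightarrow> 'a criterion"

definition inner_nodes :: "'a flow_diagram \<Rightarrow> nat set" where
  "inner_nodes F = nodes F - {source F, sink F}"

definition is_flow_diagram :: "'a criterion set \<Rightarrow> 'a flow_diagram \<Rightarrow> bool" where
  "is_flow_diagram \<C> F \<longleftrightarrow>
     finite (nodes F) \<and> edges F \<subseteq> nodes F \<times> nodes F \<and> acyclic (edges F) \<and>
     source F \<in> nodes F \<and> sink F \<in> nodes F \<and> source F \<noteq> sink F \<and>
     (\<forall>v. (v, source F) \<notin> edges F) \<and> (\<forall>v. (sink F, v) \<notin> edges F) \<and>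
     (\<forall>v \<in> inner_nodes F. label F v \<in> \<C>)"

definition segmentation :: "'a list \<Rightarrow> 'a list list \<Rightarrow> bool" where
  "segmentation \<tau> \<sigma>s \<longleftrightarrow> concat \<sigma>s = \<tau> \<and> [] \<notin> set \<sigma>s"

text \<open>\<open>vs\<close> are the inner nodes of the path.\<close>

definition st_path :: "'a flow_diagram \<Rightarrow> nat list \<Rightarrow> bool" where
  "st_path F vs \<longleftrightarrow> successively (\<lambda>u v. (u, v) \<in> edges F) (source F # vs @ [sink F])"

definition valid_for :: "'a list list \<Rightarrow> 'a flow_diagram \<Rightarrow> bool" where
  "valid_for \<T> F \<longleftrightarrow> (\<exists>\<sigma> v.
     (\<forall>i < length \<T>. segmentation (\<T> ! i) (\<sigma> i) \<and> length (v i) = length (\<sigma> i) \<and> st_path F (v i)) \<and>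
     (\<forall>u \<in> inner_nodes F.
        label F u {\<sigma> i ! j | i j. i < length \<T> \<and> j < length (\<sigma> i) \<and> v i ! j = u}))"

definition has_flow_diagram :: "'a list list \<Rightarrow> 'a criterion set \<Rightarrow> nat \<Rightarrow> bool" where
  "has_flow_diagram \<T> \<C> l \<longleftrightarrow>
     (\<exists>F. is_flow_diagram \<C> F \<and> valid_for \<T> F \<and> card (nodes F) \<le> l)"


section \<open>The flow diagram problem\<close>

text \<open>
  As part of an input, a criterion is given by a program deciding it and, in unary, a bound on the
  running time of that program; so evaluating a criterion takes polynomial time.  States are
  arbitrary trees.  Being a predicate on sets of segments, a criterion must not depend on an
  enumeration of the segments; hence the program receives them in increasing order with
  respect to an arbitrarily fixed linear order on trees (lexicographically by the preorder
  traversal).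
\<close>

primrec preorder_bits :: "data \<Rightarrow> bool list" where
  "preorder_bits Atom = [False]"
| "preorder_bits (Pair a b) = True # preorder_bits a @ preorder_bits b"

lemma preorder_bits_append_eq:
  "preorder_bits a @ xs = preorder_bits b @ ys \<Longrightarrow> a = b \<and> xs = ys"
proof (induction a arbitrary: b xs ys)
  case Atom
  then show ?case by (cases b) auto
next
  case (Pair a1 a2)
  show ?case
  proof (cases b)
    case Atom
    with Pair.prems show ?thesis by simp
  next
    case b: (Pair b1 b2)
    with Pair.prems have
      "preorder_bits a1 @ (preorder_bits a2 @ xs) = preorder_bits b1 @ (preorder_bits b2 @ ys)"
      by simp
    then have *: "a1 = b1" "preorder_bits a2 @ xs = preorder_bits b2 @ ys"
      using Pair.IH(1) by blast+
    from *(2) have "a2 = b2 \<and> xs = ys" by (rule Pair.IH(2))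
    with *(1) b show ?thesis by simp
  qed
qed

lemma preorder_bits_inject [simp]: "preorder_bits a = preorder_bits b \<longleftrightarrow> a = b"
  using preorder_bits_append_eq[of a "[]" b "[]"] by auto

instantiation data :: linorder
begin

definition less_eq_data :: "data \<Rightarrow> data \<Rightarrow> bool" where
  "a \<le> b \<longleftrightarrow> preorder_bits a \<le> preorder_bits b"

definition less_data :: "data \<Rightarrow> data \<Rightarrow> bool" where
  "a < b \<longleftrightarrow> preorder_bits a < preorder_bits b"

instance
  by standard
    (auto simp: less_eq_data_def less_data_def less_le_not_le
      dest: order.antisym)

end

type_synonym criterion_code = "com \<times> nat"

definition criterion_of :: "criterion_code \<Rightarrow> data criterion" where
  "criterion_of = (\<lambda>(c, b) S. \<exists>t \<le> b. \<exists>y.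
     computes_in c (enc_list (sorted_list_of_set (enc_list ` S))) t y \<and> y \<noteq> Atom)"

definition enc_instance :: "data list list \<Rightarrow> criterion_code list \<Rightarrow> nat \<Rightarrow> data" where
  "enc_instance \<T> cs l =
     Pair (enc_list (map enc_list \<T>))
       (Pair (enc_list (map (\<lambda>(c, b). Pair (enc_com c) (enc_nat b)) cs)) (enc_bin l))"

lemma enc_instance_inject [simp]:
  "enc_instance \<T> cs l = enc_instance \<T>' cs' l' \<longleftrightarrow> \<T> = \<T>' \<and> cs = cs' \<and> l = l'"
  by (auto simp: enc_instance_def inj_map_eq_map inj_def)

definition FD_instances :: "(data list list \<times> criterion_code list \<times> nat) set" where
  "FD_instances = {(\<T>, cs, l). 2 < l}"

text \<open>The flow diagram problem on a class of instances, parameterized by the number of state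
  sequences.\<close>

definition FD_on :: "(data list list \<times> criterion_code list \<times> nat) set \<Rightarrow> problem" where
  "FD_on I = {(enc_instance \<T> cs l, length \<T>) | \<T> cs l.
     (\<T>, cs, l) \<in> I \<and> has_flow_diagram \<T> (criterion_of ` set cs) l}"

definition FD :: problem where
  "FD = FD_on FD_instances"

definition FD_criteria :: "nat \<Rightarrow> problem" where
  "FD_criteria q = FD_on {(\<T>, cs, l) \<in> FD_instances. length cs \<le> q}"

end

theory Submission
  imports Defs
begin

text \<open>
  Weighted circuit satisfiability reduces to FD with one criterion and four nodes.  For a circuit
  given as a list of gates and a weight \<open>k\<close>, take \<open>k\<close> copies of the gate list as state
  sequences, and one more sequence consisting of a single control state that stores the circuit and
  \<open>k\<close>.  Splitting a copy into a prefix and a suffix amounts to selecting a position, namely an input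
  gate to be set to true.  A criterion may be any polynomial time predicate; ours is vacuous on sets
  of segments without control state, and otherwise verifies everything at once: that the stored
  list is a circuit of the required weft and depth, that exactly \<open>k\<close> of its positions are selected by
  the suffixes in the set, that they are input gates, and that they satisfy the circuit.  The
  control state has to pass through some inner node, so this test cannot be avoided.  As the bound
  on the weft is just one of the tests, the argument works for every level of the W-hierarchy.

  Polynomial time computability is obtained from closure properties of a class of functions
  on trees, the main one being closure under folds whose accumulator grows by a polynomially bounded
  amount in each step.
\<close>

section \<open>Basic properties of executions\<close>

text \<open>The two directions are asymmetric. Any valid diagram, of whatever shape, has an inner
  node whose set contains the control state, and that set alone exhibits a satisfying assignment.
  The copies and the four nodes serve the opposite direction: one copy for each true input, one
  inner node for prefixes and one for suffixes, besides source and sink.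

  A criterion carries its time bound in unary, so the reduction has to write down a sufficient
  bound, and the bound must itself be computable in polynomial time. It only has to cover the sets
  occurring in the intended diagram, with at most \<open>k + 1\<close> segments: a bound that is too
  small elsewhere can only reject, which never creates a false solution.

  Every reduction must be total, and an arbitrary tree may turn up where a circuit is expected. So
  lists are read off arbitrary trees, and the criterion rather than the reduction checks that the
  stored tree encodes a circuit.\<close>

inductive_cases Assign_elim: "exec (Assign x e) s t s'"
inductive_cases Seq_elim: "exec (Seq c d) s t s'"
inductive_cases IfElse_elim: "exec (IfElse e c d) s t s'"
inductive_cases While_elim: "exec (While e c) s t s'"

text \<open>For use where a criterion only asserts that some run accepts: that run must be the one
  known to compute the intended value.\<close>

lemma exec_det: "exec c s t s' \<Longrightarrow> exec c s u s'' \<Longrightarrow> t = u \<and> s' = s''"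
proof (induction arbitrary: u s'' rule: exec.induct)
  case (Assign x e s)
  then show ?case by (auto elim: Assign_elim)
next
  case (Seq c s t s' d v r)
  from Seq.prems obtain t1 r1 u1 where *: "exec c s t1 r1" "exec d r1 u1 s''" "u = t1 + u1"
    by (rule Seq_elim)
  from Seq.IH(1)[OF *(1)] Seq.IH(2) *(2,3) show ?case by auto
next
  case (IfTrue s e c t s' d)
  from IfTrue.prems IfTrue.hyps(1) obtain t1 where "exec c s t1 s''" "u = 1 + expr_cost s e + t1"
    by (auto elim: IfElse_elim)
  with IfTrue.IH[OF this(1)] show ?case by simp
next
  case (IfFalse s e d t s' c)
  from IfFalse.prems IfFalse.hyps(1) obtain t1 where "exec d s t1 s''" "u = 1 + expr_cost s e + t1"
    by (auto elim: IfElse_elim)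
  with IfFalse.IH[OF this(1)] show ?case by simp
next
  case (WhileFalse s e c)
  then show ?case by (auto elim: While_elim)
next
  case (WhileTrue s e c t s' v r)
  from WhileTrue.prems WhileTrue.hyps(1) obtain t1 r1 u1 where
    *: "exec c s t1 r1" "exec (While e c) r1 u1 s''" "u = 1 + expr_cost s e + t1 + u1"
    by (auto elim: While_elim)
  from WhileTrue.IH(1)[OF *(1)] WhileTrue.IH(2) *(2,3) show ?case by auto
qed

lemma dsize_pos [simp]: "0 < dsize x"
  by (cases x) auto

lemma one_le_dsize [simp]: "Suc 0 \<le> dsize x"
  by (cases x) auto

lemma dsize_hd_le: "dsize (hd_data x) \<le> dsize x"
  by (cases x) auto

lemma dsize_tl_le: "dsize (tl_data x) \<le> dsize x"
  by (cases x) auto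

lemma dsize_enc_nat [simp]: "dsize (enc_nat n) = 2 * n + 1"
  by (induction n) auto

lemma dsize_expr_val_le: "dsize (expr_val s e) \<le> expr_cost s e"
  by (induction e) auto

text \<open>The cost of an assignment includes the size of the value produced, so time bounds
  growth. This controls the output size of polynomial time functions and of the first of two
  composed reductions.\<close>

lemma exec_dsize_le: "exec c s t s' \<Longrightarrow> dsize (s' v) \<le> dsize (s v) + t"
proof (induction rule: exec.induct)
  case (Assign x e s)
  then show ?case using dsize_expr_val_le[of s e] by auto
qed auto

primrec expr_vars :: "expr \<Rightarrow> nat set" where
  "expr_vars (EVar x) = {x}"
| "expr_vars (EConst d) = {}"
| "expr_vars (ECons e f) = expr_vars e \<union> expr_vars f"
| "expr_vars (EHd e) = expr_vars e"
| "expr_vars (ETl e) = expr_vars e"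
| "expr_vars (EEq e f) = expr_vars e \<union> expr_vars f"

primrec com_vars :: "com \<Rightarrow> nat set" where
  "com_vars (Assign x e) = insert x (expr_vars e)"
| "com_vars (Seq c d) = com_vars c \<union> com_vars d"
| "com_vars (IfElse e c d) = expr_vars e \<union> com_vars c \<union> com_vars d"
| "com_vars (While e c) = expr_vars e \<union> com_vars c"

lemma finite_expr_vars [simp]: "finite (expr_vars e)"
  by (induction e) auto

lemma finite_com_vars [simp]: "finite (com_vars c)"
  by (induction c) auto

lemma expr_val_update [simp]: "w \<notin> expr_vars e \<Longrightarrow> expr_val (s(w := d)) e = expr_val s e"
  by (induction e) auto

lemma expr_cost_update [simp]: "w \<notin> expr_vars e \<Longrightarrow> expr_cost (s(w := d)) e = expr_cost s e"
  by (induction e) auto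

lemma exec_unchanged: "exec c s t s' \<Longrightarrow> w \<notin> com_vars c \<Longrightarrow> s' w = s w"
  by (induction rule: exec.induct) auto

lemma exec_update:
  "exec c s t s' \<Longrightarrow> w \<notin> com_vars c \<Longrightarrow> exec c (s(w := d)) t (s'(w := d))"
proof (induction rule: exec.induct)
  case (Assign x e s)
  then have "w \<noteq> x" "w \<notin> expr_vars e" by auto
  with exec.Assign[of x e "s(w := d)"] show ?case
    by (simp only: fun_upd_twist[of w x] expr_val_update expr_cost_update not_False_eq_True)
next
  case (Seq c s t s' d' u s'')
  then show ?case by (auto intro: exec.Seq)
next
  case (IfTrue s e c t s' d')
  have "exec c (s(w := d)) t (s'(w := d))" by (rule IfTrue.IH) (use IfTrue.prems in auto)
  then have "exec (IfElse e c d') (s(w := d)) (1 + expr_cost (s(w := d)) e + t) (s'(w := d))"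
    using IfTrue by (intro exec.IfTrue) auto
  moreover have "w \<notin> expr_vars e" using IfTrue.prems by simp
  ultimately show ?case by (simp only: expr_cost_update not_False_eq_True)
next
  case (IfFalse s e d' t s' c)
  have "exec d' (s(w := d)) t (s'(w := d))" by (rule IfFalse.IH) (use IfFalse.prems in auto)
  then have "exec (IfElse e c d') (s(w := d)) (1 + expr_cost (s(w := d)) e + t) (s'(w := d))"
    using IfFalse by (intro exec.IfFalse) auto
  moreover have "w \<notin> expr_vars e" using IfFalse.prems by simp
  ultimately show ?case by (simp only: expr_cost_update not_False_eq_True)
next
  case (WhileFalse s e c)
  then have "exec (While e c) (s(w := d)) (1 + expr_cost (s(w := d)) e) (s(w := d))"
    by (intro exec.WhileFalse) auto
  moreover have "w \<notin> expr_vars e" using WhileFalse.prems by simp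
  ultimately show ?case by (simp only: expr_cost_update not_False_eq_True)
next
  case (WhileTrue s e c t s' u s'')
  have "exec c (s(w := d)) t (s'(w := d))" by (rule WhileTrue.IH(1)) (use WhileTrue.prems in auto)
  moreover have "exec (While e c) (s'(w := d)) u (s''(w := d))"
    by (rule WhileTrue.IH(2)) (use WhileTrue.prems in auto)
  ultimately have "exec (While e c) (s(w := d)) (1 + expr_cost (s(w := d)) e + t + u) (s''(w := d))"
    using WhileTrue by (intro exec.WhileTrue[where s' = "s'(w := d)"]) auto
  moreover have "w \<notin> expr_vars e" using WhileTrue.prems by simp
  ultimately show ?case by (simp only: expr_cost_update not_False_eq_True)
qed

section \<open>Initial stores and the removal of leftover values\<close>

definition init_store :: "data \<Rightarrow> store" where
  "init_store x = (\<lambda>_. Atom)(0 := x)"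

lemma computes_in_init_store: "computes_in c x t y \<longleftrightarrow> (\<exists>s. exec c (init_store x) t s \<and> s 0 = y)"
  by (simp add: computes_in_def init_store_def)

primrec clear_vars :: "nat \<Rightarrow> com" where
  "clear_vars 0 = Assign 1 (EConst Atom)"
| "clear_vars (Suc n) = Seq (clear_vars n) (Assign (Suc (Suc n)) (EConst Atom))"

lemma exec_clear_vars:
  "exec (clear_vars n) s (2 * Suc n) (\<lambda>v. if 0 < v \<and> v \<le> Suc n then Atom else s v)"
proof (induction n)
  case 0
  have "s(1 := Atom) = (\<lambda>v. if 0 < v \<and> v \<le> Suc 0 then Atom else s v)" by auto
  then show ?case using exec.Assign[of 1 "EConst Atom" s] by (simp add: numeral_2_eq_2)
next
  case (Suc n)
  let ?s = "\<lambda>v. if 0 < v \<and> v \<le> Suc n then Atom else s v"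
  have "?s(Suc (Suc n) := Atom) = (\<lambda>v. if 0 < v \<and> v \<le> Suc (Suc n) then Atom else s v)"
    by (auto simp: le_Suc_eq)
  then show ?case
    using exec.Seq[OF Suc exec.Assign[of "Suc (Suc n)" "EConst Atom" ?s]] by (simp add: numeral_2_eq_2)
qed

text \<open>The auxiliary variable \<open>w\<close> lets a caller save a value across the run.\<close>

lemma cleaning_program:
  obtains c' N K where
    "\<And>x t y w d. computes_in c x t y \<Longrightarrow> N \<le> w \<Longrightarrow>
       exec c' ((init_store x)(w := d)) (t + K) ((init_store y)(w := d))"
    "0 < N"
proof -
  obtain M where M: "\<forall>v\<in>com_vars c. v \<le> M"
    using finite_com_vars[of c] finite_nat_set_iff_bounded_le by blast
  \<comment> \<open>\<open>clear_vars M\<close> resets the variables 1 to \<open>M + 1\<close>, so a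
    saved value is safe from \<open>M + 2\<close> on.\<close>
  have "exec (Seq c (clear_vars M)) ((init_store x)(w := d)) (t + 2 * Suc M)
      ((init_store y)(w := d))"
    if xy: "computes_in c x t y" and w: "Suc (Suc M) \<le> w" for x t y w d
  proof -
    from xy obtain s where s: "exec c (init_store x) t s" "s 0 = y"
      by (auto simp: computes_in_init_store)
    have "w \<notin> com_vars c" using M w by fastforce
    with s(1) have 1: "exec c ((init_store x)(w := d)) t (s(w := d))" by (rule exec_update)
    have "s v = Atom" if "M < v" for v
    proof -
      have "v \<notin> com_vars c" using M that by fastforce
      from exec_unchanged[OF s(1) this] that show ?thesis by (simp add: init_store_def)
    qed
    then have "(\<lambda>v. if 0 < v \<and> v \<le> Suc M then Atom else (s(w := d)) v) = (init_store y)(w := d)"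
      using w s(2) by (auto simp: init_store_def)
    then show ?thesis using exec.Seq[OF 1 exec_clear_vars[of M]] by simp
  qed
  then show ?thesis by (rule that) auto
qed


section \<open>Polynomial time functions on trees\<close>

named_theorems pbound_intros

text \<open>Sizes are at least 1, so exponents can be raised freely and a single monomial can
  replace a polynomial.\<close>

definition pbound :: "(data \<Rightarrow> nat) \<Rightarrow> bool" where
  "pbound T \<longleftrightarrow> (\<exists>K a. \<forall>x. T x \<le> K * dsize x ^ a)"

lemma pboundI: "(\<And>x. T x \<le> K * dsize x ^ a) \<Longrightarrow> pbound T"
  by (auto simp: pbound_def)

lemma pbound_mono: "pbound U \<Longrightarrow> (\<And>x. T x \<le> U x) \<Longrightarrow> pbound T"
  unfolding pbound_def by (meson order_trans)

lemma pbound_const [pbound_intros]: "pbound (\<lambda>_. n)"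
  by (rule pboundI[of _ n 0]) simp

lemma pbound_dsize [pbound_intros]: "pbound dsize"
  by (rule pboundI[of _ 1 1]) simp

lemma pbound_add [pbound_intros]:
  assumes "pbound T" "pbound U"
  shows "pbound (\<lambda>x. T x + U x)"
proof -
  from assms obtain K a L b where
    *: "\<And>x. T x \<le> K * dsize x ^ a" "\<And>x. U x \<le> L * dsize x ^ b" by (auto simp: pbound_def)
  show ?thesis
  proof (rule pboundI)
    fix x
    have "T x \<le> K * dsize x ^ (a + b)"
      using *(1)[of x] by (rule order_trans) (simp add: power_increasing)
    moreover have "U x \<le> L * dsize x ^ (a + b)"
      using *(2)[of x] by (rule order_trans) (simp add: power_increasing)
    ultimately show "T x + U x \<le> (K + L) * dsize x ^ (a + b)" by (simp add: add_mult_distrib)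
  qed
qed

lemma pbound_mult [pbound_intros]:
  assumes "pbound T" "pbound U"
  shows "pbound (\<lambda>x. T x * U x)"
proof -
  from assms obtain K a L b where
    *: "\<And>x. T x \<le> K * dsize x ^ a" "\<And>x. U x \<le> L * dsize x ^ b" by (auto simp: pbound_def)
  show ?thesis
  proof (rule pboundI)
    fix x
    have "T x * U x \<le> (K * dsize x ^ a) * (L * dsize x ^ b)"
      using * by (intro mult_mono) auto
    then show "T x * U x \<le> (K * L) * dsize x ^ (a + b)" by (simp add: power_add mult_ac)
  qed
qed

lemma pbound_power [pbound_intros]: "pbound T \<Longrightarrow> pbound (\<lambda>x. T x ^ n)"
  by (induction n) (auto intro: pbound_const pbound_mult)

lemma pbound_comp:
  assumes "pbound T" "pbound (\<lambda>x. dsize (f x))"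
  shows "pbound (\<lambda>x. T (f x))"
proof -
  from assms(1) obtain K a where *: "\<And>x. T x \<le> K * dsize x ^ a" by (auto simp: pbound_def)
  have "pbound (\<lambda>x. K * dsize (f x) ^ a)" by (intro pbound_intros assms(2))
  then show ?thesis by (rule pbound_mono) (use * in auto)
qed

text \<open>Programs leave everything but variable 0 unchanged and rely on only finitely many variables
  being \<open>Atom\<close>, so that they can be composed.\<close>

definition clean_below :: "nat \<Rightarrow> store \<Rightarrow> bool" where
  "clean_below N s \<longleftrightarrow> (\<forall>v. 0 < v \<and> v < N \<longrightarrow> s v = Atom)"

lemma clean_below_mono: "clean_below N s \<Longrightarrow> M \<le> N \<Longrightarrow> clean_below M s"
  by (auto simp: clean_below_def)

lemma clean_below_update_0 [simp]: "clean_below N (s(0 := d)) = clean_below N s"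
  by (auto simp: clean_below_def)

lemma clean_below_update: "N \<le> v \<Longrightarrow> clean_below N s \<Longrightarrow> clean_below N (s(v := d))"
  by (auto simp: clean_below_def)

lemma clean_below_init_store [simp]: "clean_below N (init_store x)"
  by (auto simp: clean_below_def init_store_def)

definition runs :: "com \<Rightarrow> nat \<Rightarrow> (data \<Rightarrow> nat) \<Rightarrow> (data \<Rightarrow> data) \<Rightarrow> bool" where
  "runs c N T f \<longleftrightarrow>
     (\<forall>s. clean_below N s \<longrightarrow> (\<exists>t \<le> T (s 0). exec c s t (s(0 := f (s 0)))))"

definition ptime :: "(data \<Rightarrow> data) \<Rightarrow> bool" where
  "ptime f \<longleftrightarrow> (\<exists>c N T. pbound T \<and> runs c N T f)"

lemma runsD:
  assumes "runs c N T f" "clean_below N s"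
  obtains t where "t \<le> T (s 0)" "exec c s t (s(0 := f (s 0)))"
  using assms by (auto simp: runs_def)

lemma exec_within: "exec c s t s' \<Longrightarrow> t \<le> T \<Longrightarrow> \<exists>t\<le>T. exec c s t s'"
  by blast

lemma runs_computes_in: "runs c N T f \<Longrightarrow> \<exists>t \<le> T x. computes_in c x t (f x)"
  using runsD[of c N T f "init_store x"]
  by (metis clean_below_init_store computes_in_init_store fun_upd_same init_store_def)

lemma ptime_pbound_dsize:
  assumes "ptime f"
  shows "pbound (\<lambda>x. dsize (f x))"
proof -
  from assms obtain c N T where T: "pbound T" and r: "runs c N T f" by (auto simp: ptime_def)
  have "pbound (\<lambda>x. dsize x + T x)" by (intro pbound_intros T)
  moreover have "dsize (f x) \<le> dsize x + T x" for x
  proof -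
    from runs_computes_in[OF r, of x] obtain t s where
      "t \<le> T x" "exec c (init_store x) t s" "s 0 = f x" by (auto simp: computes_in_init_store)
    with exec_dsize_le[of c "init_store x" t s 0] show ?thesis by (simp add: init_store_def)
  qed
  ultimately show ?thesis by (rule pbound_mono)
qed

lemma ptime_expr:
  assumes "\<And>s. expr_val s e = f (s 0)" "\<And>s. expr_cost s e \<le> T (s 0)" "pbound T"
  shows "ptime f"
proof -
  have "runs (Assign 0 e) 0 (\<lambda>x. 1 + T x) f"
    unfolding runs_def
    using exec_within[OF exec.Assign[of 0 e]] assms(1,2) by (metis add_left_mono)
  moreover have "pbound (\<lambda>x. 1 + T x)" by (intro pbound_intros assms(3))
  ultimately show ?thesis by (auto simp: ptime_def)
qed

lemma ptime_comp:
  assumes "ptime f" "ptime g"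
  shows "ptime (\<lambda>x. f (g x))"
proof -
  from assms obtain c M T d N U where
    *: "pbound T" "runs c M T f" "pbound U" "runs d N U g" by (auto simp: ptime_def)
  have "runs (Seq d c) (max M N) (\<lambda>x. U x + T (g x)) (\<lambda>x. f (g x))"
    unfolding runs_def
  proof (intro allI impI)
    fix s assume s: "clean_below (max M N) s"
    obtain t where t: "t \<le> U (s 0)" "exec d s t (s(0 := g (s 0)))"
      using runsD[OF *(4) clean_below_mono[OF s]] by auto
    obtain u where u: "u \<le> T (g (s 0))" "exec c (s(0 := g (s 0))) u (s(0 := f (g (s 0))))"
      using runsD[OF *(2), of "s(0 := g (s 0))"] clean_below_mono[OF s, of M] by auto
    show "\<exists>t\<le>U (s 0) + T (g (s 0)). exec (Seq d c) s t (s(0 := f (g (s 0))))"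
      by (rule exec_within[OF exec.Seq[OF t(2) u(2)]]) (use t(1) u(1) in simp)
  qed
  moreover have "pbound (\<lambda>x. U x + T (g x))"
    by (intro pbound_intros *(3) pbound_comp[OF *(1) ptime_pbound_dsize[OF assms(2)]])
  ultimately show ?thesis by (auto simp: ptime_def)
qed

section \<open>Closure under pairing, branching and loops\<close>

named_theorems ptime_intros

lemma ptime_id [ptime_intros]: "ptime (\<lambda>x. x)"
  by (rule ptime_expr[of "EVar 0" _ dsize]) (auto intro: pbound_intros)

lemma ptime_const [ptime_intros]: "ptime (\<lambda>_. d)"
  by (rule ptime_expr[of "EConst d" _ "\<lambda>_. dsize d"]) (auto intro: pbound_intros)

lemma ptime_hd [ptime_intros]: "ptime f \<Longrightarrow> ptime (\<lambda>x. hd_data (f x))"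
  by (rule ptime_comp[of hd_data], rule ptime_expr[of "EHd (EVar 0)" _ "\<lambda>x. dsize x + dsize x"])
    (simp_all add: dsize_hd_le pbound_intros)

lemma ptime_tl [ptime_intros]: "ptime f \<Longrightarrow> ptime (\<lambda>x. tl_data (f x))"
  by (rule ptime_comp[of tl_data], rule ptime_expr[of "ETl (EVar 0)" _ "\<lambda>x. dsize x + dsize x"])
    (simp_all add: dsize_tl_le pbound_intros)

text \<open>Both programs work on variable 0, so the input and the first result are parked in
  \<open>V\<close> and \<open>Suc V\<close>. These lie beyond the variables that either program
  wants clean, each program restores them by \<open>runs\<close>, and \<open>Suc\<close> in the
  choice of \<open>V\<close> keeps them apart from variable 0.\<close>

lemma ptime_Pair [ptime_intros]:
  assumes "ptime f" "ptime g"
  shows "ptime (\<lambda>x. Pair (f x) (g x))"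
proof -
  from assms obtain c M T d N U where
    *: "pbound T" "runs c M T f" "pbound U" "runs d N U g" by (auto simp: ptime_def)
  define V where "V = Suc (max M N)"
  let ?p = "Seq (Assign V (EVar 0)) (Seq c (Seq (Assign (Suc V) (EVar 0)) (Seq (Assign 0 (EVar V))
    (Seq d (Seq (Assign 0 (ECons (EVar (Suc V)) (EVar 0)))
      (Seq (Assign V (EConst Atom)) (Assign (Suc V) (EConst Atom))))))))"
  let ?T = "\<lambda>x. (1 + dsize x) + (T x + ((1 + dsize (f x)) + ((1 + dsize x) + (U x +
    ((1 + (2 * dsize (f x) + 2 * dsize (g x) + 1)) + (2 + 2))))))"
  have "runs ?p (Suc (Suc V)) ?T (\<lambda>x. Pair (f x) (g x))"
    unfolding runs_def
  proof (intro allI impI)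
    fix s assume s: "clean_below (Suc (Suc V)) s"
    let ?x = "s 0"
    have V: "0 < V" "M \<le> V" "N \<le> V" by (auto simp: V_def)
    have sV: "s V = Atom" "s (Suc V) = Atom" using s V by (auto simp: clean_below_def)
    have cl: "clean_below M s" "clean_below N s" using s V by (auto intro: clean_below_mono)
    define s1 where "s1 = s(V := ?x)"
    define s2 where "s2 = s1(0 := f ?x)"
    define s3 where "s3 = s2(Suc V := f ?x)"
    define s4 where "s4 = s3(0 := ?x)"
    define s5 where "s5 = s4(0 := g ?x)"
    define s6 where "s6 = s5(0 := Pair (f ?x) (g ?x))"
    define s7 where "s7 = s6(V := Atom)"
    note defs = s1_def s2_def s3_def s4_def s5_def s6_def s7_def
    have e1: "exec (Assign V (EVar 0)) s (1 + dsize ?x) s1"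
      using exec.Assign[of V "EVar 0" s] by (simp add: defs)
    have "clean_below M s1" using cl V by (simp add: defs clean_below_update)
    then obtain t2 where t2: "t2 \<le> T ?x" and e2: "exec c s1 t2 s2"
      using runsD[OF *(2), of s1] V by (auto simp: defs)
    have e3: "exec (Assign (Suc V) (EVar 0)) s2 (1 + dsize (f ?x)) s3"
      using exec.Assign[of "Suc V" "EVar 0" s2] by (simp add: defs)
    have e4: "exec (Assign 0 (EVar V)) s3 (1 + dsize ?x) s4"
      using exec.Assign[of 0 "EVar V" s3] V by (simp add: defs)
    have "clean_below N s4" using cl V by (simp add: defs clean_below_update)
    then obtain t5 where t5: "t5 \<le> U ?x" and e5: "exec d s4 t5 s5"
      using runsD[OF *(4), of s4] by (auto simp: defs)
    have e6: "exec (Assign 0 (ECons (EVar (Suc V)) (EVar 0))) s5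
        (1 + (2 * dsize (f ?x) + 2 * dsize (g ?x) + 1)) s6"
      using exec.Assign[of 0 "ECons (EVar (Suc V)) (EVar 0)" s5] V
      by (simp add: defs algebra_simps mult_2)
    have e7: "exec (Assign V (EConst Atom)) s6 2 s7"
      using exec.Assign[of V "EConst Atom" s6] unfolding s7_def by (simp add: numeral_2_eq_2)
    have e8: "exec (Assign (Suc V) (EConst Atom)) s7 2 (s7(Suc V := Atom))"
      using exec.Assign[of "Suc V" "EConst Atom" s7] by (simp add: numeral_2_eq_2)
    have "s7(Suc V := Atom) = s(0 := Pair (f ?x) (g ?x))"
      using sV V by (auto simp: defs)
    with exec.Seq[OF e1 exec.Seq[OF e2 exec.Seq[OF e3 exec.Seq[OF e4 exec.Seq[OF e5
            exec.Seq[OF e6 exec.Seq[OF e7 e8]]]]]]]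
    have "exec ?p s ((1 + dsize ?x) + (t2 + ((1 + dsize (f ?x)) + ((1 + dsize ?x) + (t5 +
      ((1 + (2 * dsize (f ?x) + 2 * dsize (g ?x) + 1)) + (2 + 2)))))))
      (s(0 := Pair (f ?x) (g ?x)))" by simp
    then show "\<exists>t\<le>?T ?x. exec ?p s t (s(0 := Pair (f ?x) (g ?x)))"
      by (rule exec_within) (use t2 t5 in simp)
  qed
  moreover have "pbound ?T"
    by (intro pbound_add pbound_mult pbound_const pbound_dsize *(1,3)
        ptime_pbound_dsize[OF assms(1)] ptime_pbound_dsize[OF assms(2)])
  ultimately show ?thesis unfolding ptime_def by blast
qed

definition data_of_bool :: "bool \<Rightarrow> data" where
  "data_of_bool b = (if b then Pair Atom Atom else Atom)"

lemma data_of_bool_eq_Atom [simp]: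
  "data_of_bool b = Atom \<longleftrightarrow> \<not> b" "Atom = data_of_bool b \<longleftrightarrow> \<not> b"
  by (auto simp: data_of_bool_def)

lemma dsize_data_of_bool: "dsize (data_of_bool b) \<le> 3"
  by (auto simp: data_of_bool_def)

lemma ptime_eq [ptime_intros]:
  assumes "ptime f" "ptime g"
  shows "ptime (\<lambda>x. data_of_bool (f x = g x))"
proof -
  have "ptime (\<lambda>p. data_of_bool (hd_data p = tl_data p))"
  proof (rule ptime_expr[of "EEq (EHd (EVar 0)) (ETl (EVar 0))"])
    show "expr_cost s (EEq (EHd (EVar 0)) (ETl (EVar 0))) \<le> 4 * dsize (s 0) + 3" for s
      using dsize_hd_le[of "s 0"] dsize_tl_le[of "s 0"] by simp
    show "pbound (\<lambda>x. 4 * dsize x + 3)" by (intro pbound_intros)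
  qed (simp add: data_of_bool_def)
  from ptime_comp[OF this ptime_Pair[OF assms]] show ?thesis by simp
qed

text \<open>The condition is computed into a pair together with the input. Branching on the head and
  then passing to the tail recovers the input that evaluating the condition would have
  overwritten.\<close>

lemma ptime_if_Atom:
  assumes "ptime h" "ptime f" "ptime g"
  shows "ptime (\<lambda>x. if h x = Atom then g x else f x)"
proof -
  from assms obtain c M T d N U where
    *: "pbound T" "runs c M T f" "pbound U" "runs d N U g" by (auto simp: ptime_def)
  let ?h = "\<lambda>p. if hd_data p = Atom then g (tl_data p) else f (tl_data p)"
  let ?p = "IfElse (EHd (EVar 0)) (Seq (Assign 0 (ETl (EVar 0))) c) (Seq (Assign 0 (ETl (EVar 0))) d)"
  let ?T = "\<lambda>x. 1 + (dsize x + dsize x) + ((1 + (dsize x + dsize x)) + (T (tl_data x) + U (tl_data x)))"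
  have "runs ?p (max M N) ?T ?h"
    unfolding runs_def
  proof (intro allI impI)
    fix s assume s: "clean_below (max M N) s"
    let ?s = "s(0 := tl_data (s 0))"
    have cl: "clean_below M ?s" "clean_below N ?s" using s by (auto intro: clean_below_mono)
    have hdc: "expr_cost s (EHd (EVar 0)) \<le> dsize (s 0) + dsize (s 0)"
      by (simp add: dsize_hd_le)
    have tlc: "expr_cost s (ETl (EVar 0)) \<le> dsize (s 0) + dsize (s 0)"
      by (simp add: dsize_tl_le)
    have tl: "exec (Assign 0 (ETl (EVar 0))) s (1 + expr_cost s (ETl (EVar 0))) ?s"
      using exec.Assign[of 0 "ETl (EVar 0)" s] by simp
    show "\<exists>t\<le>?T (s 0). exec ?p s t (s(0 := ?h (s 0)))"
    proof (cases "hd_data (s 0) = Atom")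
      case True
      obtain u where u: "u \<le> U (tl_data (s 0))" "exec d ?s u (s(0 := g (tl_data (s 0))))"
        using runsD[OF *(4) cl(2)] by auto
      from exec.IfFalse[OF _ exec.Seq[OF tl u(2)], of "EHd (EVar 0)"] True
      have "exec ?p s (1 + expr_cost s (EHd (EVar 0)) + ((1 + expr_cost s (ETl (EVar 0))) + u))
        (s(0 := ?h (s 0)))" by simp
      then show ?thesis by (rule exec_within) (use u(1) hdc tlc in linarith)
    next
      case False
      obtain u where u: "u \<le> T (tl_data (s 0))" "exec c ?s u (s(0 := f (tl_data (s 0))))"
        using runsD[OF *(2) cl(1)] by auto
      from exec.IfTrue[OF _ exec.Seq[OF tl u(2)], of "EHd (EVar 0)"] False
      have "exec ?p s (1 + expr_cost s (EHd (EVar 0)) + ((1 + expr_cost s (ETl (EVar 0))) + u))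
        (s(0 := ?h (s 0)))" by simp
      then show ?thesis by (rule exec_within) (use u(1) hdc tlc in linarith)
    qed
  qed
  moreover have "pbound ?T"
    by (intro pbound_add pbound_const pbound_dsize pbound_comp[OF *(1)] pbound_comp[OF *(3)]
        ptime_pbound_dsize ptime_intros)
  ultimately have "ptime ?h" unfolding ptime_def by blast
  from ptime_comp[OF this ptime_Pair[OF assms(1) ptime_id]] show ?thesis by (simp cong: if_cong)
qed

lemma ptime_if [ptime_intros]:
  assumes "ptime (\<lambda>x. data_of_bool (P x))" "ptime f" "ptime g"
  shows "ptime (\<lambda>x. if P x then f x else g x)"
proof -
  have "(\<lambda>x. if data_of_bool (P x) = Atom then g x else f x) = (\<lambda>x. if P x then f x else g x)"
    by auto
  with ptime_if_Atom[OF assms] show ?thesis by simp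
qed

lemma ptime_not [ptime_intros]:
  assumes "ptime (\<lambda>x. data_of_bool (P x))"
  shows "ptime (\<lambda>x. data_of_bool (\<not> P x))"
  using ptime_eq[OF assms ptime_const[of Atom]] by simp

lemma ptime_conj [ptime_intros]:
  assumes "ptime (\<lambda>x. data_of_bool (P x))" "ptime (\<lambda>x. data_of_bool (Q x))"
  shows "ptime (\<lambda>x. data_of_bool (P x \<and> Q x))"
proof -
  have "(\<lambda>x. data_of_bool (P x \<and> Q x)) = (\<lambda>x. if P x then data_of_bool (Q x) else Atom)" by auto
  then show ?thesis using ptime_if[OF assms ptime_const] by simp
qed

lemma ptime_disj [ptime_intros]:
  assumes "ptime (\<lambda>x. data_of_bool (P x))" "ptime (\<lambda>x. data_of_bool (Q x))"
  shows "ptime (\<lambda>x. data_of_bool (P x \<or> Q x))"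
  using ptime_not[OF ptime_conj[OF ptime_not[OF assms(1)] ptime_not[OF assms(2)]]] by simp

lemma ptime_imp [ptime_intros]:
  assumes "ptime (\<lambda>x. data_of_bool (P x))" "ptime (\<lambda>x. data_of_bool (Q x))"
  shows "ptime (\<lambda>x. data_of_bool (P x \<longrightarrow> Q x))"
  using ptime_disj[OF ptime_not[OF assms(1)] assms(2)] unfolding imp_conv_disj .

text \<open>The head of the state is the loop guard. Bounding the number of iterations is not
  enough: each could square the size of the state, so all intermediate states must be bounded by one
  polynomial in the input.\<close>

lemma ptime_loop:
  assumes step: "ptime step" and ini: "ptime ini" and M: "pbound M" and B: "pbound B"
    and *: "\<And>x. \<exists>m \<le> M x. f x = (step ^^ m) (ini x) \<and> hd_data (f x) = Atom \<and>
      (\<forall>i < m. hd_data ((step ^^ i) (ini x)) \<noteq> Atom) \<and> (\<forall>i \<le> m. dsize ((step ^^ i) (ini x)) \<le> B x)"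
  shows "ptime f"
proof -
  from step obtain c N T where T: "pbound T" and c: "runs c N T step" by (auto simp: ptime_def)
  from T obtain K a where K: "\<And>x. T x \<le> K * dsize x ^ a" by (auto simp: pbound_def)
  from ini obtain d N' U where U: "pbound U" and d: "runs d N' U ini" by (auto simp: ptime_def)
  let ?w = "While (EHd (EVar 0)) c"
  \<comment> \<open>The cost of one iteration on a state of size at most \<open>b\<close>:
    evaluating the guard costs at most \<open>1 + 2 * b\<close>, the body at most
    \<open>K * b ^ a\<close>.\<close>
  define D where "D b = 1 + 2 * b + K * b ^ a" for b
  have loop: "\<exists>t \<le> Suc m * D b. exec ?w s t (s(0 := (step ^^ m) (s 0)))"
    if "clean_below N s" "hd_data ((step ^^ m) (s 0)) = Atom"
      "\<forall>i < m. hd_data ((step ^^ i) (s 0)) \<noteq> Atom" "\<forall>i \<le> m. dsize ((step ^^ i) (s 0)) \<le> b" for s m b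
    using that
  proof (induction m arbitrary: s)
    case 0
    have "exec ?w s (1 + expr_cost s (EHd (EVar 0))) s"
      by (rule exec.WhileFalse) (use 0 in simp)
    moreover have "1 + (dsize (s 0) + 1) \<le> 1 + 2 * b"
      using one_le_dsize[of "s 0"] 0(4)[rule_format, of 0] by (simp del: one_le_dsize)
    then have "1 + expr_cost s (EHd (EVar 0)) \<le> D b"
      using 0 by (simp add: D_def)
    ultimately show ?case by (auto simp del: expr_cost.simps)
  next
    case (Suc m)
    let ?s = "s(0 := step (s 0))"
    obtain t where t: "t \<le> T (s 0)" "exec c s t ?s" using runsD[OF c Suc.prems(1)] .
    have shift: "(step ^^ i) (?s 0) = (step ^^ Suc i) (s 0)" for i
      by (simp add: funpow_Suc_right del: funpow.simps)
    have "\<exists>u \<le> Suc m * D b. exec ?w ?s u (?s(0 := (step ^^ m) (?s 0)))"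
    proof (rule Suc.IH)
      show "clean_below N ?s" using Suc.prems(1) by simp
      show "hd_data ((step ^^ m) (?s 0)) = Atom" unfolding shift by (rule Suc.prems(2))
      show "\<forall>i<m. hd_data ((step ^^ i) (?s 0)) \<noteq> Atom"
        unfolding shift using Suc.prems(3) by blast
      show "\<forall>i\<le>m. dsize ((step ^^ i) (?s 0)) \<le> b"
        unfolding shift using Suc.prems(4) by blast
    qed
    then obtain u where u: "u \<le> Suc m * D b"
      "exec ?w ?s u (s(0 := (step ^^ Suc m) (s 0)))"
      unfolding shift by auto
    have s0: "dsize (s 0) \<le> b" using Suc.prems(4)[rule_format, of 0] by simp
    have ex: "exec ?w s (1 + expr_cost s (EHd (EVar 0)) + t + u) (s(0 := (step ^^ Suc m) (s 0)))"
      by (rule exec.WhileTrue[OF _ t(2) u(2)]) (use Suc.prems(3)[rule_format, of 0] in simp)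
    have "T (s 0) \<le> K * b ^ a"
      by (rule order_trans[OF K]) (use s0 in \<open>simp add: power_mono\<close>)
    then have "1 + expr_cost s (EHd (EVar 0)) + t \<le> D b"
      using t(1) s0 dsize_hd_le[of "s 0"] by (simp add: D_def)
    with u(1) have "1 + expr_cost s (EHd (EVar 0)) + t + u \<le> Suc (Suc m) * D b" by simp
    from exec_within[OF ex this] show ?case .
  qed
  have "runs (Seq d ?w) (max N N') (\<lambda>x. U x + Suc (M x) * D (B x)) f"
    unfolding runs_def
  proof (intro allI impI)
    fix s assume s: "clean_below (max N N') s"
    let ?s = "s(0 := ini (s 0))"
    obtain t where t: "t \<le> U (s 0)" "exec d s t ?s"
      using runsD[OF d clean_below_mono[OF s]] by auto
    obtain m where m: "m \<le> M (s 0)" "f (s 0) = (step ^^ m) (?s 0)" "hd_data (f (s 0)) = Atom"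
      "\<forall>i < m. hd_data ((step ^^ i) (?s 0)) \<noteq> Atom" "\<forall>i \<le> m. dsize ((step ^^ i) (?s 0)) \<le> B (s 0)"
      using *[of "s 0"] by auto
    have "clean_below N ?s" using s by (auto intro: clean_below_mono)
    then have "\<exists>t \<le> Suc m * D (B (s 0)). exec ?w ?s t (?s(0 := (step ^^ m) (?s 0)))"
      using m(3)[unfolded m(2)] m(4,5) by (rule loop)
    then obtain u where u: "u \<le> Suc m * D (B (s 0))" "exec ?w ?s u (?s(0 := (step ^^ m) (?s 0)))"
      by blast
    then have u2: "exec ?w ?s u (s(0 := f (s 0)))" by (simp only: m(2) fun_upd_upd)
    note u(1)
    also have "Suc m * D (B (s 0)) \<le> Suc (M (s 0)) * D (B (s 0))" using m(1) by simp
    finally have "u \<le> Suc (M (s 0)) * D (B (s 0))" .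
    with t(1) have "t + u \<le> U (s 0) + Suc (M (s 0)) * D (B (s 0))" by (rule add_mono)
    with exec.Seq[OF t(2) u2]
    show "\<exists>t\<le>U (s 0) + Suc (M (s 0)) * D (B (s 0)). exec (Seq d ?w) s t (s(0 := f (s 0)))"
      by (rule exec_within)
  qed
  moreover have "pbound (\<lambda>x. U x + Suc (M x) * D (B x))"
    unfolding D_def Suc_eq_plus1
    by (intro pbound_add pbound_mult pbound_const pbound_power U M B)
  ultimately show ?thesis unfolding ptime_def by blast
qed


section \<open>Folds over trees viewed as lists\<close>

text \<open>Inverse to \<open>enc_list\<close> on both sides: every tree is a list along its right
  spine, so decoding is total.\<close>

fun dlist :: "data \<Rightarrow> data list" where
  "dlist Atom = []"
| "dlist (Pair x y) = x # dlist y"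

lemma dlist_enc_list [simp]: "dlist (enc_list xs) = xs"
  by (induction xs) auto

lemma enc_list_dlist [simp]: "enc_list (dlist x) = x"
  by (induction x) auto

lemma dlist_eq_Nil [simp]: "dlist x = [] \<longleftrightarrow> x = Atom" "[] = dlist x \<longleftrightarrow> x = Atom"
  by (cases x; simp)+

lemma dlist_tl [simp]: "dlist (tl_data x) = tl (dlist x)"
  by (cases x) auto

lemma hd_data_eq: "hd_data x = (if dlist x = [] then Atom else hd (dlist x))"
  by (cases x) auto

lemma dlist_enc_nat [simp]: "dlist (enc_nat n) = replicate n Atom"
  by (induction n) auto

lemma length_dlist_le: "length (dlist x) \<le> dsize x"
  by (induction x) auto

lemma dsize_mem_dlist: "y \<in> set (dlist x) \<Longrightarrow> dsize y \<le> dsize x"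
  by (induction x) auto

text \<open>Quantifying over nonempty tails instead of entries keeps the position: the head gives
  the entry, and the length of the tail tells where it stands.\<close>

fun dtails :: "data \<Rightarrow> data set" where
  "dtails Atom = {}"
| "dtails (Pair x y) = insert (Pair x y) (dtails y)"

lemma set_dlist: "set (dlist x) = hd_data ` dtails x"
  by (induction x) auto

lemma dtails_eq: "dtails x = (\<lambda>i. enc_list (drop i (dlist x))) ` {..<length (dlist x)}"
proof (induction x)
  case (Pair x y)
  have "{..<length (dlist (Pair x y))} = insert 0 (Suc ` {..<length (dlist y)})"
    by (simp add: lessThan_Suc_eq_insert_0)
  then show ?case using Pair by (simp add: image_image)
qed simp

text \<open>The step function sees the whole remaining list, hence the current position and not only
  the entry. Since a unary number is a list of \<open>Atom\<close>s, the same recursion is also a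
  counted loop.\<close>

fun foldd :: "(data \<Rightarrow> data \<Rightarrow> data) \<Rightarrow> data \<Rightarrow> data \<Rightarrow> data" where
  "foldd h Atom acc = acc"
| "foldd h (Pair x y) acc = foldd h y (h (Pair x y) acc)"

text \<open>The loop state is \<open>Pair rest (Pair acc x)\<close>, whose head becomes
  \<open>Atom\<close> exactly when the list is exhausted. Additive growth bounds the accumulator by
  its initial size plus length times \<open>B x\<close>; growth by a factor would allow repeated
  doubling. Restricting \<open>growth\<close> to short \<open>r\<close> lets \<open>B\<close> depend
  on the list.\<close>

lemma ptime_foldd:
  assumes G: "ptime (\<lambda>e. G (hd_data e) (hd_data (tl_data e)) (tl_data (tl_data e)))"
    and l: "ptime l" and i: "ptime i" and B: "pbound B"
    and growth: "\<And>x r acc. dsize r \<le> dsize (l x) \<Longrightarrow> dsize (G r acc x) \<le> dsize acc + B x"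
  shows "ptime (\<lambda>x. foldd (\<lambda>r acc. G r acc x) (l x) (i x))"
proof -
  define step where "step p = Pair (tl_data (hd_data p))
    (Pair (G (hd_data p) (hd_data (tl_data p)) (tl_data (tl_data p))) (tl_data (tl_data p)))" for p
  define ini where "ini x = Pair (l x) (Pair (i x) x)" for x
  define f where "f x = Pair Atom (Pair (foldd (\<lambda>r acc. G r acc x) (l x) (i x)) x)" for x
  have step_eq: "step (Pair (Pair y r) (Pair acc x)) = Pair r (Pair (G (Pair y r) acc x) x)" for y r acc x
    by (simp add: step_def)
  have run: "(step ^^ length (dlist r)) (Pair r (Pair acc x)) =
        Pair Atom (Pair (foldd (\<lambda>r acc. G r acc x) r acc) x) \<and>
      (\<forall>i < length (dlist r). hd_data ((step ^^ i) (Pair r (Pair acc x))) \<noteq> Atom) \<and>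
      (\<forall>i \<le> length (dlist r). dsize ((step ^^ i) (Pair r (Pair acc x))) \<le>
        2 + dsize (l x) + (dsize acc + i * B x) + dsize x)"
    if "dsize r \<le> dsize (l x)" for r acc x
    using that
  proof (induction r arbitrary: acc)
    case Atom
    then show ?case by simp
  next
    case (Pair y r)
    let ?acc = "G (Pair y r) acc x"
    have shift: "(step ^^ Suc i) (Pair (Pair y r) (Pair acc x)) = (step ^^ i) (Pair r (Pair ?acc x))" for i
      by (simp only: funpow_Suc_right o_apply step_eq)
    have IH: "(step ^^ length (dlist r)) (Pair r (Pair ?acc x)) =
        Pair Atom (Pair (foldd (\<lambda>r acc. G r acc x) r ?acc) x)"
      "\<forall>i < length (dlist r). hd_data ((step ^^ i) (Pair r (Pair ?acc x))) \<noteq> Atom"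
      "\<forall>i \<le> length (dlist r). dsize ((step ^^ i) (Pair r (Pair ?acc x))) \<le>
        2 + dsize (l x) + (dsize ?acc + i * B x) + dsize x"
      using Pair.IH(2)[of ?acc] Pair.prems by auto
    have gr: "dsize ?acc \<le> dsize acc + B x" using Pair.prems by (rule growth)
    show ?case
    proof (intro conjI allI impI)
      show "(step ^^ length (dlist (Pair y r))) (Pair (Pair y r) (Pair acc x)) =
          Pair Atom (Pair (foldd (\<lambda>r acc. G r acc x) (Pair y r) acc) x)"
        using IH(1) by (simp only: dlist.simps list.size shift foldd.simps add_0_right add_Suc_right)
    next
      fix j assume "j < length (dlist (Pair y r))"
      then show "hd_data ((step ^^ j) (Pair (Pair y r) (Pair acc x))) \<noteq> Atom"
        using IH(2) by (cases j) (simp, simp only: shift, simp)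
    next
      fix j assume j: "j \<le> length (dlist (Pair y r))"
      show "dsize ((step ^^ j) (Pair (Pair y r) (Pair acc x))) \<le>
        2 + dsize (l x) + (dsize acc + j * B x) + dsize x"
      proof (cases j)
        case 0
        then show ?thesis using Pair.prems by simp
      next
        case (Suc k)
        then have "dsize ((step ^^ j) (Pair (Pair y r) (Pair acc x))) \<le>
          2 + dsize (l x) + (dsize ?acc + k * B x) + dsize x"
          using IH(3) j by (simp only: shift) simp
        also have "\<dots> \<le> 2 + dsize (l x) + (dsize acc + j * B x) + dsize x"
          using gr Suc by simp
        finally show ?thesis .
      qed
    qed
  qed
  have "ptime f"
  proof (rule ptime_loop)
    show "ptime step" unfolding step_def by (intro ptime_intros G)
    show "ptime ini" unfolding ini_def by (intro ptime_intros l i)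
    show "pbound (\<lambda>x. dsize (l x))" using l by (rule ptime_pbound_dsize)
    show "pbound (\<lambda>x. 2 + dsize (l x) + (dsize (i x) + dsize (l x) * B x) + dsize x)"
      by (intro pbound_intros ptime_pbound_dsize l i B)
    fix x
    let ?m = "length (dlist (l x))"
    have bound: "2 + dsize (l x) + (dsize (i x) + j * B x) + dsize x \<le>
      2 + dsize (l x) + (dsize (i x) + dsize (l x) * B x) + dsize x" if "j \<le> ?m" for j
      using that length_dlist_le[of "l x"] by (simp add: mult_right_mono)
    have "\<forall>j\<le>?m. dsize ((step ^^ j) (ini x)) \<le>
          2 + dsize (l x) + (dsize (i x) + dsize (l x) * B x) + dsize x"
      using run[of "l x" x "i x"] bound unfolding ini_def by (meson order_refl order_trans)
    then show "\<exists>m\<le>dsize (l x). f x = (step ^^ m) (ini x) \<and> hd_data (f x) = Atom \<and>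
        (\<forall>i<m. hd_data ((step ^^ i) (ini x)) \<noteq> Atom) \<and>
        (\<forall>j\<le>m. dsize ((step ^^ j) (ini x)) \<le>
          2 + dsize (l x) + (dsize (i x) + dsize (l x) * B x) + dsize x)"
      using run[of "l x" x "i x"] length_dlist_le[of "l x"]
      by (intro exI[of _ ?m]) (simp add: ini_def f_def)
  qed
  from ptime_hd[OF ptime_tl[OF this]] show ?thesis by (simp add: f_def)
qed

lemma ptime_foldd':
  assumes "ptime (\<lambda>e. G (hd_data e) (hd_data (tl_data e)) (tl_data (tl_data e)))"
    and "ptime l" and "ptime i"
    and "\<And>x r acc. dsize (G r acc x) \<le> dsize acc + K"
  shows "ptime (\<lambda>x. foldd (\<lambda>r acc. G r acc x) (l x) (i x))"
  by (rule ptime_foldd[where B = "\<lambda>_. K"]) (use assms in \<open>auto intro: pbound_intros\<close>)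

section \<open>Functions of several arguments and bounded quantifiers\<close>

lemma ptime_comp2:
  assumes "ptime (\<lambda>e. F (hd_data e) (tl_data e))" "ptime a" "ptime b"
  shows "ptime (\<lambda>x. F (a x) (b x))"
  using ptime_comp[OF assms(1) ptime_Pair[OF assms(2,3)]] by simp

lemma ptime_comp3:
  assumes "ptime (\<lambda>e. F (hd_data e) (hd_data (tl_data e)) (tl_data (tl_data e)))"
    "ptime a" "ptime b" "ptime c"
  shows "ptime (\<lambda>x. F (a x) (b x) (c x))"
  using ptime_comp[OF assms(1) ptime_Pair[OF assms(2) ptime_Pair[OF assms(3,4)]]] by simp

lemma ptime_Bex_dtails [ptime_intros]:
  assumes P: "ptime (\<lambda>e. data_of_bool (P (hd_data e) (tl_data e)))" and l: "ptime l"
  shows "ptime (\<lambda>x. data_of_bool (\<exists>r \<in> dtails (l x). P r x))"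
proof -
  have eq: "foldd (\<lambda>r acc. if P r x then Pair Atom Atom else acc) d acc =
      (if \<exists>r \<in> dtails d. P r x then Pair Atom Atom else acc)" for x d acc
    by (induction d arbitrary: acc) auto
  have "ptime (\<lambda>x. foldd (\<lambda>r acc. if P r x then Pair Atom Atom else acc) (l x) Atom)"
  proof (rule ptime_foldd'[where K = 3])
    have "ptime (\<lambda>e. data_of_bool (P (hd_data e) (tl_data (tl_data e))))"
      by (rule ptime_comp2[where F = "\<lambda>r x. data_of_bool (P r x)", OF P]) (intro ptime_intros)+
    then show "ptime (\<lambda>e. if P (hd_data e) (tl_data (tl_data e)) then Pair Atom Atom
        else hd_data (tl_data e))"
      by (intro ptime_intros)
  qed (intro ptime_intros l | simp)+
  then show ?thesis unfolding eq data_of_bool_def .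
qed

lemma ptime_Ball_dtails [ptime_intros]:
  assumes "ptime (\<lambda>e. data_of_bool (P (hd_data e) (tl_data e)))" "ptime l"
  shows "ptime (\<lambda>x. data_of_bool (\<forall>r \<in> dtails (l x). P r x))"
  using ptime_not[OF ptime_Bex_dtails[OF ptime_not[OF assms(1)] assms(2)]] by simp

lemma ptime_mem_dlist [ptime_intros]:
  assumes "ptime f" "ptime l"
  shows "ptime (\<lambda>x. data_of_bool (f x \<in> set (dlist (l x))))"
proof (rule ptime_comp2[where F = "\<lambda>y z. data_of_bool (y \<in> set (dlist z))", OF _ assms])
  have "(\<lambda>e. data_of_bool (hd_data e \<in> set (dlist (tl_data e)))) =
    (\<lambda>e. data_of_bool (\<exists>r \<in> dtails (tl_data e). hd_data e = hd_data r))"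
    by (simp add: set_dlist image_iff del: dlist_tl)
  moreover have "ptime \<dots>" by (intro ptime_intros)
  ultimately show "ptime (\<lambda>e. data_of_bool (hd_data e \<in> set (dlist (tl_data e))))" by simp
qed

section \<open>List access and arithmetic of unary numbers\<close>

definition udrop :: "data \<Rightarrow> data \<Rightarrow> data" where
  "udrop n x = foldd (\<lambda>r acc. tl_data acc) n x"

lemma dlist_udrop: "dlist (udrop n x) = drop (length (dlist n)) (dlist x)"
  unfolding udrop_def by (induction n arbitrary: x) (auto simp: drop_Suc)

lemma ptime_udrop [ptime_intros]: "ptime f \<Longrightarrow> ptime g \<Longrightarrow> ptime (\<lambda>x. udrop (f x) (g x))"
  unfolding udrop_def
  by (rule ptime_foldd'[where K = 0]; (intro ptime_intros)?; simp add: dsize_tl_le)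

definition dnth :: "data \<Rightarrow> data \<Rightarrow> data" where
  "dnth x n = hd_data (udrop n x)"

lemma dnth_eq: "dnth x n =
  (if length (dlist n) < length (dlist x) then dlist x ! length (dlist n) else Atom)"
  unfolding dnth_def hd_data_eq dlist_udrop by (simp add: hd_drop_conv_nth)

lemma ptime_dnth [ptime_intros]: "ptime f \<Longrightarrow> ptime g \<Longrightarrow> ptime (\<lambda>x. dnth (f x) (g x))"
  unfolding dnth_def by (intro ptime_intros)

lemma dsize_dnth_le: "dsize (dnth x n) \<le> dsize x"
  using dsize_mem_dlist[of "dlist x ! length (dlist n)" x] by (auto simp: dnth_eq Suc_le_eq)

definition drev :: "data \<Rightarrow> data" where
  "drev x = foldd (\<lambda>r acc. Pair (hd_data r) acc) x Atom"

lemma drev_eq: "drev x = enc_list (rev (dlist x))"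
proof -
  have "foldd (\<lambda>r acc. Pair (hd_data r) acc) x acc = enc_list (rev (dlist x) @ dlist acc)" for acc
    by (induction x arbitrary: acc) auto
  then show ?thesis by (simp add: drev_def)
qed

lemma ptime_drev [ptime_intros]:
  assumes f: "ptime f"
  shows "ptime (\<lambda>x. drev (f x))"
  unfolding drev_def
proof (rule ptime_foldd[where B = "\<lambda>x. 1 + dsize (f x)"])
  show "pbound (\<lambda>x. 1 + dsize (f x))" by (intro pbound_intros ptime_pbound_dsize f)
  show "dsize (Pair (hd_data r) acc) \<le> dsize acc + (1 + dsize (f x))"
    if "dsize r \<le> dsize (f x)" for x r acc
    using that dsize_hd_le[of r] by simp
qed (intro ptime_intros f)+

definition ulength :: "data \<Rightarrow> data" where
  "ulength x = foldd (\<lambda>r acc. Pair Atom acc) x Atom"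

definition uadd :: "data \<Rightarrow> data \<Rightarrow> data" where
  "uadd x y = foldd (\<lambda>r acc. Pair Atom acc) x y"

lemma uadd_enc_nat: "uadd x (enc_nat n) = enc_nat (length (dlist x) + n)"
proof -
  have "foldd (\<lambda>r acc. Pair Atom acc) x (enc_nat n) = enc_nat (length (dlist x) + n)"
    by (induction x arbitrary: n) (auto simp flip: enc_nat.simps(2))
  then show ?thesis by (simp add: uadd_def)
qed

lemma ulength_eq: "ulength x = enc_nat (length (dlist x))"
  using uadd_enc_nat[of x 0] by (simp add: ulength_def uadd_def)

lemma ptime_uadd [ptime_intros]: "ptime f \<Longrightarrow> ptime g \<Longrightarrow> ptime (\<lambda>x. uadd (f x) (g x))"
  unfolding uadd_def by (rule ptime_foldd'[where K = 2]; (intro ptime_intros)?; simp)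

lemma ptime_ulength [ptime_intros]: "ptime f \<Longrightarrow> ptime (\<lambda>x. ulength (f x))"
  unfolding ulength_def by (rule ptime_foldd'[where K = 2]; (intro ptime_intros)?; simp)

lemma dsize_uadd: "dsize (uadd x y) \<le> dsize y + 2 * dsize x"
  unfolding uadd_def
proof (induction x arbitrary: y)
  case (Pair x1 x2)
  from Pair.IH(2)[of "Pair Atom y"] show ?case by simp
qed simp

definition umult :: "data \<Rightarrow> data \<Rightarrow> data" where
  "umult x y = foldd (\<lambda>r acc. uadd y acc) x Atom"

lemma umult_enc_nat: "umult (enc_nat m) (enc_nat n) = enc_nat (m * n)"
proof -
  have "foldd (\<lambda>r acc. uadd (enc_nat n) acc) (enc_nat m) (enc_nat k) = enc_nat (m * n + k)" for k
    by (induction m arbitrary: k) (auto simp: uadd_enc_nat algebra_simps)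
  from this[of 0] show ?thesis by (simp add: umult_def)
qed

lemma ptime_umult [ptime_intros]: "ptime f \<Longrightarrow> ptime g \<Longrightarrow> ptime (\<lambda>x. umult (f x) (g x))"
proof (rule ptime_comp2, unfold umult_def, rule ptime_foldd[where B = "\<lambda>e. 2 * dsize (tl_data e)"])
  show "pbound (\<lambda>e. 2 * dsize (tl_data e))" by (intro pbound_intros ptime_pbound_dsize ptime_intros)
qed (intro ptime_intros dsize_uadd | assumption)+

text \<open>The proper tails of \<open>enc_nat n\<close> are exactly the numerals below
  \<open>n\<close>. So the test also certifies that \<open>x\<close> is a numeral, which matters for
  unchecked input.\<close>

definition uless :: "data \<Rightarrow> data \<Rightarrow> bool" where
  "uless x y \<longleftrightarrow> (\<exists>r \<in> dtails y. tl_data r = x)"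

lemma uless_enc_nat: "uless x (enc_nat n) \<longleftrightarrow> (\<exists>m < n. x = enc_nat m)"
  unfolding uless_def by (induction n) (auto simp: less_Suc_eq)

lemma ptime_uless [ptime_intros]:
  "ptime f \<Longrightarrow> ptime g \<Longrightarrow> ptime (\<lambda>x. data_of_bool (uless (f x) (g x)))"
  by (rule ptime_comp2[where F = "\<lambda>y z. data_of_bool (uless y z)"], unfold uless_def)
    (intro ptime_intros | assumption)+

definition umax :: "data \<Rightarrow> data \<Rightarrow> data" where
  "umax x y = (if udrop x y = Atom then x else y)"

lemma umax_enc_nat: "umax (enc_nat m) (enc_nat n) = enc_nat (max m n)"
proof -
  have "udrop (enc_nat m) (enc_nat n) = Atom \<longleftrightarrow> n \<le> m"
    using dlist_eq_Nil(1)[of "udrop (enc_nat m) (enc_nat n)"] by (simp add: dlist_udrop)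
  then show ?thesis by (auto simp: umax_def max_def)
qed

lemma ptime_umax [ptime_intros]: "ptime f \<Longrightarrow> ptime g \<Longrightarrow> ptime (\<lambda>x. umax (f x) (g x))"
  unfolding umax_def by (intro ptime_intros)

text \<open>A stack of trees is itself a tree, which is traversed by rotations.\<close>

lemma ptime_enc_nat_dsize: "ptime (\<lambda>x. enc_nat (dsize x))"
proof -
  \<comment> \<open>The state pairs a stack with a unary counter. A leaf on top is popped, an inner
    node is replaced by its two children. Each step counts one node, so \<open>dsize x\<close> steps
    remove \<open>x\<close> from the stack.\<close>
  define step where "step p = (if hd_data (hd_data p) = Atom
     then Pair (tl_data (hd_data p)) (Pair Atom (tl_data p))
     else Pair (Pair (hd_data (hd_data (hd_data p)))
       (Pair (tl_data (hd_data (hd_data p))) (tl_data (hd_data p)))) (Pair Atom (tl_data p)))" for p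
  have step_Atom: "step (Pair (Pair Atom r) acc) = Pair r (Pair Atom acc)" for r acc
    by (simp add: step_def)
  have step_Pair: "step (Pair (Pair (Pair y z) r) acc) = Pair (Pair y (Pair z r)) (Pair Atom acc)"
    for y z r acc by (simp add: step_def)
  have run: "(step ^^ dsize x) (Pair (Pair x r) (enc_nat n)) = Pair r (enc_nat (n + dsize x)) \<and>
      (\<forall>i < dsize x. hd_data ((step ^^ i) (Pair (Pair x r) (enc_nat n))) \<noteq> Atom) \<and>
      (\<forall>i \<le> dsize x. dsize ((step ^^ i) (Pair (Pair x r) (enc_nat n))) \<le>
        3 + dsize x + dsize r + 2 * n + 4 * i)" for x r n
  proof (induction x arbitrary: r n)
    case Atom
    have "(step ^^ i) (Pair (Pair Atom r) (enc_nat n)) =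
        (if i = 0 then Pair (Pair Atom r) (enc_nat n) else Pair r (enc_nat (Suc n)))" if "i \<le> 1" for i
      using that step_Atom[of r "enc_nat n"] by (cases i) auto
    then show ?case by (auto simp: le_Suc_eq step_Atom)
  next
    case (Pair y z)
    let ?p = "\<lambda>i. (step ^^ i) (Pair (Pair (Pair y z) r) (enc_nat n))"
    have p0: "?p 0 = Pair (Pair (Pair y z) r) (enc_nat n)" by simp
    have p1: "?p (Suc i) = (step ^^ i) (Pair (Pair y (Pair z r)) (enc_nat (Suc n)))" for i
      by (simp only: funpow_Suc_right o_apply step_Pair enc_nat.simps)
    \<comment> \<open>Once the root and all nodes of \<open>y\<close> are counted, \<open>z\<close>
      is on top of the stack.\<close>
    have p2: "?p (Suc (dsize y) + i) = (step ^^ i) (Pair (Pair z r) (enc_nat (Suc n + dsize y)))" for i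
    proof -
      have "?p (Suc (dsize y) + i) =
          (step ^^ (i + dsize y)) (Pair (Pair y (Pair z r)) (enc_nat (Suc n)))"
        using p1[of "i + dsize y"] by (simp only: add.commute[of i] add_Suc)
      then show ?thesis using Pair.IH(1)[of "Pair z r" "Suc n"] by (simp only: funpow_add o_apply)
    qed
    have cases: "i = 0 \<or> (\<exists>j < dsize y. i = Suc j) \<or> (\<exists>j. i = Suc (dsize y) + j)" for i
      by presburger
    show ?case
    proof (intro conjI allI impI)
      have "?p (Suc (dsize y) + dsize z) = Pair r (enc_nat (Suc n + dsize y + dsize z))"
        unfolding p2 using Pair.IH(2)[of r "Suc n + dsize y"] by blast
      then show "?p (dsize (Pair y z)) = Pair r (enc_nat (n + dsize (Pair y z)))"
        by (simp only: dsize.simps) (simp add: add.assoc)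
    next
      fix i assume i: "i < dsize (Pair y z)"
      consider "i = 0" | j where "j < dsize y" "i = Suc j" | j where "i = Suc (dsize y) + j"
        using cases[of i] by blast
      then show "hd_data (?p i) \<noteq> Atom"
      proof cases
        case 1
        then show ?thesis by simp
      next
        case 2
        then show ?thesis unfolding 2(2) p1 using Pair.IH(1)[of "Pair z r" "Suc n"] by blast
      next
        case 3
        then have "j < dsize z" using i by simp
        then show ?thesis unfolding 3 p2 using Pair.IH(2)[of r "Suc n + dsize y"] by blast
      qed
    next
      fix i assume i: "i \<le> dsize (Pair y z)"
      consider "i = 0" | j where "j < dsize y" "i = Suc j" | j where "i = Suc (dsize y) + j"
        using cases[of i] by blast
      then show "dsize (?p i) \<le> 3 + dsize (Pair y z) + dsize r + 2 * n + 4 * i"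
      proof cases
        case 1
        then show ?thesis by simp
      next
        case 2
        then have "dsize (?p i) \<le> 3 + dsize y + dsize (Pair z r) + 2 * Suc n + 4 * j"
          unfolding 2(2) p1 using Pair.IH(1)[of "Pair z r" "Suc n"] by simp
        then show ?thesis using 2 by simp
      next
        case 3
        then have "j \<le> dsize z" using i by simp
        then have "dsize (?p i) \<le> 3 + dsize z + dsize r + 2 * (Suc n + dsize y) + 4 * j"
          unfolding 3 p2 using Pair.IH(2)[of r "Suc n + dsize y"] by blast
        then show ?thesis using 3 by simp
      qed
    qed
  qed
  have "ptime (\<lambda>x. Pair Atom (enc_nat (dsize x)))"
  proof (rule ptime_loop)
    show "ptime step" unfolding step_def by (intro ptime_intros)
    show "ptime (\<lambda>x. Pair (Pair x Atom) (enc_nat 0))" by (intro ptime_intros)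
    show "pbound dsize" "pbound (\<lambda>x. 4 + 5 * dsize x)" by (intro pbound_intros)+
    fix x
    have "\<forall>i\<le>dsize x. dsize ((step ^^ i) (Pair (Pair x Atom) (enc_nat 0))) \<le> 4 + 5 * dsize x"
    proof (intro allI impI)
      fix i assume i: "i \<le> dsize x"
      then have "dsize ((step ^^ i) (Pair (Pair x Atom) (enc_nat 0))) \<le>
          3 + dsize x + dsize Atom + 2 * 0 + 4 * i"
        using run[of x Atom 0] by blast
      then show "dsize ((step ^^ i) (Pair (Pair x Atom) (enc_nat 0))) \<le> 4 + 5 * dsize x"
        using i by simp
    qed
    then show "\<exists>m\<le>dsize x. Pair Atom (enc_nat (dsize x)) = (step ^^ m) (Pair (Pair x Atom) (enc_nat 0)) \<and>
       hd_data (Pair Atom (enc_nat (dsize x))) = Atom \<and>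
       (\<forall>i<m. hd_data ((step ^^ i) (Pair (Pair x Atom) (enc_nat 0))) \<noteq> Atom) \<and>
       (\<forall>i\<le>m. dsize ((step ^^ i) (Pair (Pair x Atom) (enc_nat 0))) \<le> 4 + 5 * dsize x)"
      using run[of x Atom 0] by (intro exI[of _ "dsize x"]) simp
  qed
  from ptime_tl[OF this] show ?thesis by simp
qed

lemma ptime_enc_nat_mult:
  "ptime (\<lambda>x. enc_nat (m x)) \<Longrightarrow> ptime (\<lambda>x. enc_nat (n x)) \<Longrightarrow> ptime (\<lambda>x. enc_nat (m x * n x))"
  using ptime_umult[of "\<lambda>x. enc_nat (m x)" "\<lambda>x. enc_nat (n x)"] by (simp add: umult_enc_nat)

text \<open>Turns a bound that merely exists into one that can be written down in unary: for the
  time bound in a criterion code, and for the computable function bounding a composed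
  reduction.\<close>

lemma pbound_ptime_enc_nat:
  assumes "pbound T"
  obtains h where "ptime (\<lambda>x. enc_nat (h x))" "\<And>x. T x \<le> h x"
proof -
  from assms obtain K a where K: "\<And>x. T x \<le> K * dsize x ^ a" by (auto simp: pbound_def)
  have "ptime (\<lambda>x. enc_nat (dsize x ^ a))" for a
  proof (induction a)
    case 0
    then show ?case using ptime_const[of "enc_nat 1"] by simp
  next
    case (Suc a)
    then show ?case using ptime_enc_nat_mult[OF ptime_enc_nat_dsize Suc] by simp
  qed
  then have "ptime (\<lambda>x. enc_nat (K * dsize x ^ a))"
    by (intro ptime_enc_nat_mult ptime_const)
  from that[OF this K] show ?thesis .
qed


section \<open>Composing parameterized reductions with polynomial time ones\<close>

text \<open>The time of the second of two composed reductions is polynomial in both the parameter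
  and the bound \<open>f k\<close> of the first, so \<open>h\<close> receives the pair. The program
  saves \<open>k\<close> in variable \<open>N\<close> while \<open>f k\<close> is computed.\<close>

lemma computable_ptime_comp:
  assumes f: "computable f" and h: "ptime (\<lambda>x. enc_nat (h x))"
  shows "computable (\<lambda>k. h (Pair (enc_nat k) (enc_nat (f k))))"
proof -
  from f obtain c where c: "\<And>k. \<exists>t. computes_in c (enc_nat k) t (enc_nat (f k))"
    by (auto simp: computable_def)
  obtain c' N K where c': "\<And>x t y w d. computes_in c x t y \<Longrightarrow> N \<le> w \<Longrightarrow>
       exec c' ((init_store x)(w := d)) (t + K) ((init_store y)(w := d))" and N: "0 < N"
    using cleaning_program[of c] by metis
  from h obtain d M T where d: "runs d M T (\<lambda>x. enc_nat (h x))" by (auto simp: ptime_def)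
  let ?p = "Seq (Assign N (EVar 0)) (Seq c' (Seq (Assign 0 (ECons (EVar N) (EVar 0)))
    (Seq (Assign N (EConst Atom)) d)))"
  have "\<exists>t. computes_in ?p (enc_nat k) t (enc_nat (h (Pair (enc_nat k) (enc_nat (f k)))))" for k
  proof -
    let ?x = "enc_nat k" and ?y = "enc_nat (f k)"
    obtain t where "computes_in c ?x t ?y" using c by blast
    from c'[OF this order_refl]
    have e2: "exec c' ((init_store ?x)(N := ?x)) (t + K) ((init_store ?y)(N := ?x))" .
    have e1: "\<exists>u. exec (Assign N (EVar 0)) (init_store ?x) u ((init_store ?x)(N := ?x))"
      using exec.Assign[of N "EVar 0" "init_store ?x"] by (auto simp: init_store_def)
    let ?s = "((init_store ?y)(N := ?x))(0 := Pair ?x ?y)"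
    have e3: "\<exists>u. exec (Assign 0 (ECons (EVar N) (EVar 0))) ((init_store ?y)(N := ?x)) u ?s"
      using exec.Assign[of 0 "ECons (EVar N) (EVar 0)" "(init_store ?y)(N := ?x)"] N
      by (auto simp: init_store_def)
    have "?s(N := Atom) = init_store (Pair ?x ?y)"
      using N by (auto simp: init_store_def)
    then have e4: "\<exists>u. exec (Assign N (EConst Atom)) ?s u (init_store (Pair ?x ?y))"
      using exec.Assign[of N "EConst Atom" ?s] by (metis expr_val.simps(2))
    have e5: "\<exists>u. exec d (init_store (Pair ?x ?y)) u
        ((init_store (Pair ?x ?y))(0 := enc_nat (h (Pair ?x ?y))))"
      using runsD[OF d clean_below_init_store[of M "Pair ?x ?y"]] by (metis fun_upd_same init_store_def)
    obtain u where "exec ?p (init_store ?x) u ((init_store (Pair ?x ?y))(0 := enc_nat (h (Pair ?x ?y))))"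
      using e1 e2 e3 e4 e5 exec.Seq by meson
    then show ?thesis unfolding computes_in_init_store by (metis fun_upd_same)
  qed
  then show ?thesis by (auto simp: computable_def)
qed

lemma computable_Suc:
  assumes "computable f"
  shows "computable (\<lambda>k. Suc (f k))"
proof -
  from assms obtain c where c: "\<And>k. \<exists>t. computes_in c (enc_nat k) t (enc_nat (f k))"
    by (auto simp: computable_def)
  have "\<exists>t. computes_in (Seq c (Assign 0 (ECons (EConst Atom) (EVar 0)))) (enc_nat k) t
      (enc_nat (Suc (f k)))" for k
  proof -
    obtain t s where s: "exec c (init_store (enc_nat k)) t s" "s 0 = enc_nat (f k)"
      using c[of k] unfolding computes_in_init_store by blast
    from exec.Seq[OF s(1) exec.Assign[of 0 "ECons (EConst Atom) (EVar 0)" s]] s(2)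
    show ?thesis unfolding computes_in_init_store
      by (metis enc_nat.simps(2) expr_val.simps(1-3) fun_upd_same)
  qed
  then show ?thesis by (auto simp: computable_def)
qed

text \<open>The parameter becomes \<open>Suc l\<close> because one control sequence joins the
  \<open>l\<close> copies.\<close>

lemma fpt_reducible_ptime:
  assumes PQ: "P \<le>\<^sub>f\<^sub>p\<^sub>t Q" and R: "ptime R"
    and R_eq: "\<And>y l. R (Pair y (enc_nat l)) = Pair (r y l) (enc_nat (Suc l))"
    and Q': "\<And>y l. (y, l) \<in> Q \<longleftrightarrow> (r y l, Suc l) \<in> Q'"
  shows "P \<le>\<^sub>f\<^sub>p\<^sub>t Q'"
proof -
  from PQ obtain c f g a where f: "computable f" and g: "computable g" and
    c: "\<And>x k. \<exists>t y l. computes_in c (Pair x (enc_nat k)) t (Pair y (enc_nat l)) \<and>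
        t \<le> f k * dsize x ^ a \<and> l \<le> g k \<and> ((x, k) \<in> P \<longleftrightarrow> (y, l) \<in> Q)"
    unfolding fpt_reducible_def by metis
  obtain c' N K where c': "\<And>x t y w d. computes_in c x t y \<Longrightarrow> N \<le> w \<Longrightarrow>
       exec c' ((init_store x)(w := d)) (t + K) ((init_store y)(w := d))" and "0 < N"
    using cleaning_program[of c] by metis
  have clean: "exec c' (init_store x) (t + K) (init_store y)" if "computes_in c x t y" for x t y
  proof -
    have "(init_store z)(N := Atom) = init_store z" for z
      using \<open>0 < N\<close> by (auto simp: init_store_def)
    with c'[OF that order_refl, of Atom] show ?thesis by simp
  qed
  from R obtain d M T where T: "pbound T" and d: "runs d M T R" by (auto simp: ptime_def)
  from T obtain L b where L: "\<And>x. T x \<le> L * dsize x ^ b" by (auto simp: pbound_def)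
  \<comment> \<open>At the pair of \<open>k\<close> and \<open>f k\<close> the three summands pay
    for the given reduction, for clearing its variables and for \<open>R\<close>, each up to a power
    of the input size.\<close>
  define U where "U x = dsize x + K + L * dsize x ^ b" for x
  have "pbound U" unfolding U_def by (intro pbound_intros)
  then obtain h where h: "ptime (\<lambda>x. enc_nat (h x))" "\<And>x. U x \<le> h x"
    using pbound_ptime_enc_nat by metis
  define F where "F k = h (Pair (enc_nat k) (enc_nat (f k)))" for k
  have "computable F" unfolding F_def using f h(1) by (rule computable_ptime_comp)
  moreover have "\<exists>t y l. computes_in (Seq c' d) (Pair x (enc_nat k)) t (Pair y (enc_nat l)) \<and>
      t \<le> F k * dsize x ^ (Suc a * Suc b) \<and> l \<le> Suc (g k) \<and> ((x, k) \<in> P \<longleftrightarrow> (y, l) \<in> Q')" for x k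
  proof -
    let ?x = "Pair x (enc_nat k)" and ?n = "dsize x"
    obtain t y l where t: "computes_in c ?x t (Pair y (enc_nat l))" "t \<le> f k * ?n ^ a" "l \<le> g k"
      "(x, k) \<in> P \<longleftrightarrow> (y, l) \<in> Q"
      using c[of x k] by blast
    let ?y = "Pair y (enc_nat l)"
    obtain u where u: "u \<le> T ?y" "exec d (init_store ?y) u (init_store (R ?y))"
      using runsD[OF d clean_below_init_store[of M ?y]] by (auto simp: init_store_def)
    have "computes_in (Seq c' d) ?x (t + K + u) (R ?y)"
      unfolding computes_in_init_store using exec.Seq[OF clean[OF t(1)] u(2)]
      by (auto simp: init_store_def)
    moreover have "t + K + u \<le> F k * ?n ^ (Suc a * Suc b)"
    proof -
      \<comment> \<open>\<open>m\<close> depends on \<open>k\<close> only. The intermediate instance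
        has size at most \<open>m * dsize x ^ Suc a\<close>, so a bound polynomial in that size
        splits into a function of \<open>k\<close> times a power of \<open>dsize x\<close>.\<close>
      define m where "m = dsize (Pair (enc_nat k) (enc_nat (f k)))"
      have m: "m = 3 + 2 * k + 2 * f k" by (simp add: m_def)
      have n: "1 \<le> ?n" by simp
      have na: "1 \<le> ?n ^ a" using n by (rule one_le_power)
      have fm: "f k * ?n ^ a \<le> f k * ?n ^ Suc a"
        by (intro mult_le_mono2 power_increasing) auto
      obtain s where s: "exec c (init_store ?x) t s" "s 0 = ?y"
        using t(1) by (auto simp: computes_in_init_store)
      have "dsize ?y \<le> dsize ?x + t"
        using exec_dsize_le[OF s(1), of 0] s(2) by (simp add: init_store_def)
      also have "\<dots> \<le> (?n + 2 + 2 * k) + f k * ?n ^ Suc a"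
        using order_trans[OF t(2) fm] by (simp del: power_Suc)
      also have "\<dots> \<le> (3 + 2 * k) * ?n ^ Suc a + f k * ?n ^ Suc a"
      proof -
        have "?n \<le> ?n ^ Suc a" "1 \<le> ?n ^ Suc a" using n na by simp_all
        then have "?n + (2 + 2 * k) * 1 \<le> ?n ^ Suc a + (2 + 2 * k) * ?n ^ Suc a"
          by (intro add_mono mult_le_mono2)
        then show ?thesis by (simp add: algebra_simps)
      qed
      also have "\<dots> \<le> m * ?n ^ Suc a" unfolding m by (simp add: algebra_simps)
      finally have y: "dsize ?y \<le> m * ?n ^ Suc a" .
      have "u \<le> L * dsize ?y ^ b" using u(1) L[of ?y] by simp
      also have "\<dots> \<le> L * (m * ?n ^ Suc a) ^ b" using y by (intro mult_le_mono2 power_mono) auto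
      also have "\<dots> = L * m ^ b * ?n ^ (Suc a * b)"
        by (simp only: power_mult_distrib power_mult mult.assoc)
      also have "\<dots> \<le> L * m ^ b * ?n ^ (Suc a * Suc b)"
        by (intro mult_le_mono2 power_increasing) auto
      finally have u': "u \<le> L * m ^ b * ?n ^ (Suc a * Suc b)" .
      have "t \<le> f k * ?n ^ (Suc a * Suc b)"
        using t(2) by (rule order_trans) (intro mult_le_mono2 power_increasing, auto)
      also have "\<dots> \<le> m * ?n ^ (Suc a * Suc b)" unfolding m by simp
      finally have t': "t \<le> m * ?n ^ (Suc a * Suc b)" .
      have "1 \<le> ?n ^ (Suc a * Suc b)" using n by (rule one_le_power)
      then have K': "K \<le> K * ?n ^ (Suc a * Suc b)" using mult_le_mono2[of 1 _ K] by simp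
      have "t + K + u \<le> (m + K + L * m ^ b) * ?n ^ (Suc a * Suc b)"
        using t' K' u' by (simp only: add_mult_distrib)
      also have "m + K + L * m ^ b \<le> F k"
        using h(2)[of "Pair (enc_nat k) (enc_nat (f k))"] by (simp only: F_def U_def m_def)
      finally show ?thesis by (simp add: mult_right_mono)
    qed
    ultimately show ?thesis using t(3,4) Q'[of y l] unfolding R_eq by (metis Suc_le_mono)
  qed
  ultimately show ?thesis
    unfolding fpt_reducible_def using computable_Suc[OF g] by blast
qed


section \<open>Checking circuits in polynomial time\<close>

text \<open>Dynamic programming.  The entries are accumulated in reverse order, so that the last one comes
  first.\<close>

definition dp :: "(data \<Rightarrow> data \<Rightarrow> data) \<Rightarrow> data \<Rightarrow> data" where
  "dp G x = foldd (\<lambda>r acc. Pair (G r (drev acc)) acc) x Atom"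

text \<open>Entries of constant size keep the growth of the table additive, as required for
  folds.\<close>

lemma ptime_dp:
  assumes G: "ptime (\<lambda>e. G (hd_data e) (hd_data (tl_data e)) (tl_data (tl_data e)))"
    and l: "ptime l" and K: "\<And>x r v. dsize (G r v x) \<le> K"
  shows "ptime (\<lambda>x. dp (\<lambda>r v. G r v x) (l x))"
  unfolding dp_def
proof (rule ptime_foldd'[where K = "Suc K"])
  show "ptime (\<lambda>e. Pair (G (hd_data e) (drev (hd_data (tl_data e))) (tl_data (tl_data e)))
    (hd_data (tl_data e)))"
    by (intro ptime_intros ptime_comp3[OF G])
qed (use K in \<open>auto intro: l ptime_const\<close>)

text \<open>Generalised over the entries \<open>U\<close> already in the table, so that the
  induction over the remaining list goes through.\<close>

lemma foldd_dp:
  "\<exists>V. foldd (\<lambda>r acc. Pair (G r (drev acc)) acc) x (enc_list (rev U)) = enc_list (rev (U @ V)) \<and>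
     length V = length (dlist x) \<and>
     (\<forall>i < length V. V ! i = G (enc_list (drop i (dlist x))) (enc_list (U @ take i V)))"
proof (induction x arbitrary: U)
  case Atom
  then show ?case by simp
next
  case (Pair y x)
  let ?v = "G (Pair y x) (enc_list U)"
  obtain V where V: "foldd (\<lambda>r acc. Pair (G r (drev acc)) acc) x (enc_list (rev (U @ [?v]))) =
      enc_list (rev ((U @ [?v]) @ V))" "length V = length (dlist x)"
    "\<forall>i < length V. V ! i = G (enc_list (drop i (dlist x))) (enc_list ((U @ [?v]) @ take i V))"
    using Pair.IH(2)[of "U @ [?v]"] by blast
  have "(?v # V) ! i = G (enc_list (drop i (dlist (Pair y x)))) (enc_list (U @ take i (?v # V)))"
    if "i < length (?v # V)" for i
    using that V(3) by (cases i) auto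
  with V(1,2) show ?case by (intro exI[of _ "?v # V"]) (simp add: drev_eq)
qed

lemma dp_entries:
  obtains V where "dlist (dp G x) = rev V" "length V = length (dlist x)"
    "\<And>i. i < length (dlist x) \<Longrightarrow> V ! i = G (enc_list (drop i (dlist x))) (enc_list (take i V))"
  using foldd_dp[of G x "[]"] unfolding dp_def by force

lemma hd_data_last_entry: "dlist y = rev V \<Longrightarrow> V \<noteq> [] \<Longrightarrow> hd_data y = V ! (length V - 1)"
  by (simp add: hd_data_eq hd_rev last_conv_nth)

lemma Ball_dtails_hd: "(\<forall>r \<in> dtails x. P (hd_data r)) \<longleftrightarrow> (\<forall>y \<in> set (dlist x). P y)"
  by (simp add: set_dlist)

lemma Bex_dtails_hd: "(\<exists>r \<in> dtails x. P (hd_data r)) \<longleftrightarrow> (\<exists>y \<in> set (dlist x). P y)"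
  by (simp add: set_dlist)

lemma dlist_enc_circuit [simp]: "dlist (enc_circuit C) = map enc_gate C"
  by (simp add: enc_circuit_def)

lemma dp_entries_circuit:
  obtains V where "dlist (dp G (enc_circuit C)) = rev V" "length V = length C"
    "\<And>i. i < length C \<Longrightarrow>
       V ! i = G (enc_list (drop i (map enc_gate C))) (enc_list (take i V))"
proof -
  obtain V where "dlist (dp G (enc_circuit C)) = rev V"
    "length V = length (dlist (enc_circuit C))"
    "\<And>i. i < length (dlist (enc_circuit C)) \<Longrightarrow>
       V ! i = G (enc_list (drop i (dlist (enc_circuit C)))) (enc_list (take i V))"
    by (rule dp_entries) (rule that)
  then show ?thesis by (intro that[of V]) simp_all
qed


subsection \<open>Well-formedness\<close>

definition dpreds :: "data \<Rightarrow> data" where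
  "dpreds d = (if hd_data d = enc_nat 0 then Atom
     else if hd_data d = enc_nat 1 then Pair (tl_data d) Atom else tl_data d)"

lemma dlist_dpreds_enc_gate [simp]: "dlist (dpreds (enc_gate g)) = map enc_nat (preds g)"
  by (cases g) (auto simp: dpreds_def simp del: enc_nat.simps)

lemma ptime_dpreds [ptime_intros]: "ptime f \<Longrightarrow> ptime (\<lambda>x. dpreds (f x))"
  unfolding dpreds_def by (intro ptime_intros)

text \<open>\<open>n\<close> is the position of the gate. \<open>Atom\<close> is excluded explicitly
  because its head is \<open>Atom\<close>, which is also the tag \<open>enc_nat 0\<close> of an
  input gate. Numerals in the payload are certified by \<open>uless\<close>.\<close>

definition gate_ok :: "data \<Rightarrow> data \<Rightarrow> bool" where
  "gate_ok n d \<longleftrightarrow> d \<noteq> Atom \<and>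
     (hd_data d = enc_nat 0 \<and> tl_data d = Atom \<or> hd_data d = enc_nat 1 \<or>
      (hd_data d = enc_nat 2 \<or> hd_data d = enc_nat 3) \<and> tl_data (tl_data d) \<noteq> Atom) \<and>
     (\<forall>r \<in> dtails (dpreds d). uless (hd_data r) n)"

lemma ptime_gate_ok:
  "ptime f \<Longrightarrow> ptime g \<Longrightarrow> ptime (\<lambda>x. data_of_bool (gate_ok (f x) (g x)))"
  by (rule ptime_comp2[where F = "\<lambda>y z. data_of_bool (gate_ok y z)"], unfold gate_ok_def)
    (intro ptime_intros | assumption)+

lemma tl_data_neq_Atom: "tl_data x \<noteq> Atom \<longleftrightarrow> 2 \<le> length (dlist x)"
  using dlist_eq_Nil(1)[of "tl_data x"] by (cases "dlist x") (auto simp: Suc_le_eq)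

lemma gate_ok_iff:
  "gate_ok (enc_nat n) d \<longleftrightarrow>
     (\<exists>g. d = enc_gate g \<and> fan_in_ok g \<and> (\<forall>j \<in> set (preds g). j < n))"
proof
  assume ok: "gate_ok (enc_nat n) d"
  then obtain t a where d: "d = Pair t a" by (cases d) (auto simp: gate_ok_def)
  have preds: "\<forall>y \<in> set (dlist (dpreds d)). \<exists>m < n. y = enc_nat m"
    using ok by (simp add: gate_ok_def set_dlist uless_enc_nat)
  consider "t = enc_nat 0" "a = Atom" | "t = enc_nat 1"
    | "t = enc_nat 2 \<or> t = enc_nat 3" "2 \<le> length (dlist a)"
    using ok d by (auto simp: gate_ok_def tl_data_neq_Atom simp del: enc_nat.simps)
  then show "\<exists>g. d = enc_gate g \<and> fan_in_ok g \<and> (\<forall>j \<in> set (preds g). j < n)"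
  proof cases
    case 1
    with d show ?thesis by (intro exI[of _ InpG]) simp
  next
    case 2
    with d preds obtain m where "m < n" "a = enc_nat m"
      by (auto simp: dpreds_def simp del: enc_nat.simps)
    with 2 d show ?thesis by (intro exI[of _ "NotG m"]) (simp del: enc_nat.simps)
  next
    case 3
    with d preds have "\<forall>y \<in> set (dlist a). \<exists>m < n. y = enc_nat m"
      by (auto simp: dpreds_def simp del: enc_nat.simps)
    then obtain f where f: "\<forall>y \<in> set (dlist a). f y < n \<and> y = enc_nat (f y)" by metis
    then have "map (\<lambda>y. enc_nat (f y)) (dlist a) = map (\<lambda>y. y) (dlist a)" by (intro map_cong) auto
    then have "dlist a = map enc_nat (map f (dlist a))" by (simp add: o_def)
    then have a: "a = enc_list (map enc_nat (map f (dlist a)))" by (metis enc_list_dlist)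
    from 3(1) show ?thesis
    proof
      assume "t = enc_nat 2"
      with d a 3(2) f show ?thesis
        by (intro exI[of _ "AndG (map f (dlist a))"]) (auto simp del: enc_nat.simps)
    next
      assume "t = enc_nat 3"
      with d a 3(2) f show ?thesis
        by (intro exI[of _ "OrG (map f (dlist a))"]) (auto simp del: enc_nat.simps)
    qed
  qed
next
  assume "\<exists>g. d = enc_gate g \<and> fan_in_ok g \<and> (\<forall>j \<in> set (preds g). j < n)"
  then obtain g where g: "d = enc_gate g" "fan_in_ok g" "\<forall>j \<in> set (preds g). j < n" by blast
  have "\<forall>r \<in> dtails (dpreds d). uless (hd_data r) (enc_nat n)"
    unfolding Ball_dtails_hd[of "dpreds d" "\<lambda>y. uless y (enc_nat n)"] using g by (auto simp: uless_enc_nat)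
  moreover have "d \<noteq> Atom" using g by (cases g) auto
  ultimately show "gate_ok (enc_nat n) d"
    using g(1,2) by (cases g) (auto simp: gate_ok_def tl_data_neq_Atom simp del: enc_nat.simps)
qed

text \<open>The table serves only to know positions: the number of earlier entries is the position
  of the current gate.\<close>

definition circuit_ok :: "data \<Rightarrow> bool" where
  "circuit_ok x \<longleftrightarrow> x \<noteq> Atom \<and>
     (\<forall>r \<in> dtails (dp (\<lambda>r v. data_of_bool (gate_ok (ulength v) (hd_data r))) x). hd_data r \<noteq> Atom)"

lemma ptime_circuit_ok [ptime_intros]:
  assumes "ptime f"
  shows "ptime (\<lambda>x. data_of_bool (circuit_ok (f x)))"
proof (rule ptime_comp[of "\<lambda>x. data_of_bool (circuit_ok x)", OF _ assms])
  show "ptime (\<lambda>x. data_of_bool (circuit_ok x))"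
    unfolding circuit_ok_def
    by (intro ptime_intros ptime_dp[where K = 3] ptime_gate_ok dsize_data_of_bool)
qed

lemma circuit_ok_iff: "circuit_ok x \<longleftrightarrow> (\<exists>C. x = enc_circuit C \<and> is_circuit C)"
proof -
  let ?G = "\<lambda>r v. data_of_bool (gate_ok (ulength v) (hd_data r))"
  obtain V where V: "dlist (dp ?G x) = rev V" "length V = length (dlist x)"
    "\<And>i. i < length (dlist x) \<Longrightarrow> V ! i = ?G (enc_list (drop i (dlist x))) (enc_list (take i V))"
    by (rule dp_entries) (rule that)
  have gate: "hd_data (enc_list (drop i (dlist x))) = dlist x ! i" if "i < length (dlist x)" for i
    using that by (simp add: hd_data_eq hd_drop_conv_nth)
  have "circuit_ok x \<longleftrightarrow> x \<noteq> Atom \<and> (\<forall>i < length (dlist x). V ! i \<noteq> Atom)"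
    unfolding circuit_ok_def Ball_dtails_hd[of _ "\<lambda>y. y \<noteq> Atom"] V(1)
    by (auto simp: all_set_conv_all_nth V(2))
  also have "\<dots> \<longleftrightarrow> x \<noteq> Atom \<and> (\<forall>i < length (dlist x). gate_ok (enc_nat i) (dlist x ! i))"
    using V(2,3) by (simp add: gate ulength_eq min_def)
  also have "\<dots> \<longleftrightarrow> (\<exists>C. x = enc_circuit C \<and> is_circuit C)"
  proof
    assume *: "x \<noteq> Atom \<and> (\<forall>i < length (dlist x). gate_ok (enc_nat i) (dlist x ! i))"
    then obtain g where g: "\<And>i. i < length (dlist x) \<Longrightarrow> dlist x ! i = enc_gate (g i) \<and>
        fan_in_ok (g i) \<and> (\<forall>j \<in> set (preds (g i)). j < i)"
      unfolding gate_ok_iff by metis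
    let ?C = "map g [0..<length (dlist x)]"
    have "dlist x = map enc_gate ?C" using g by (intro nth_equalityI) auto
    then have "x = enc_circuit ?C" unfolding enc_circuit_def by (metis enc_list_dlist)
    moreover have "is_circuit ?C" using g * by (auto simp: is_circuit_def)
    ultimately show "\<exists>C. x = enc_circuit C \<and> is_circuit C" by blast
  next
    assume "\<exists>C. x = enc_circuit C \<and> is_circuit C"
    then obtain C where C: "x = enc_circuit C" "is_circuit C" by blast
    have "gate_ok (enc_nat i) (dlist x ! i)" if "i < length (dlist x)" for i
      unfolding gate_ok_iff using C that by (auto simp: is_circuit_def)
    moreover have "x \<noteq> Atom"
      using C dlist_eq_Nil(1)[of x] by (auto simp: is_circuit_def)
    ultimately show "x \<noteq> Atom \<and> (\<forall>i < length (dlist x). gate_ok (enc_nat i) (dlist x ! i))"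
      by blast
  qed
  finally show ?thesis .
qed


subsection \<open>Weft and depth\<close>

text \<open>The entry of a gate is the maximal number of gates satisfying \<open>w\<close> on a path from an input to
  it, capped at \<open>d + 1\<close> so that entries have constant size.\<close>

definition rank_entry :: "(data \<Rightarrow> bool) \<Rightarrow> nat \<Rightarrow> data \<Rightarrow> data \<Rightarrow> data" where
  "rank_entry w d r v =
     (let m = foldd (\<lambda>q acc. umax acc (dnth v (hd_data q))) (dpreds (hd_data r)) Atom in
      if uless m (enc_nat (Suc d)) then if w (hd_data r) then Pair Atom m else m else enc_nat (Suc d))"

text \<open>The output gate is the last one, so its entry is the head of the reversed table.\<close>

definition rank_ok :: "(data \<Rightarrow> bool) \<Rightarrow> nat \<Rightarrow> data \<Rightarrow> bool" where
  "rank_ok w d x \<longleftrightarrow> uless (hd_data (dp (rank_entry w d) x)) (enc_nat (Suc d))"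

lemma dsize_rank_entry: "dsize (rank_entry w d r v) \<le> 2 * d + 3"
  by (auto simp: rank_entry_def Let_def uless_enc_nat simp del: enc_nat.simps)

lemma ptime_rank_ok:
  assumes w: "ptime (\<lambda>x. data_of_bool (w x))" and f: "ptime f"
  shows "ptime (\<lambda>x. data_of_bool (rank_ok w d (f x)))"
proof -
  have m: "ptime (\<lambda>e. foldd (\<lambda>q acc. umax acc (dnth (tl_data e) (hd_data q)))
      (dpreds (hd_data (hd_data e))) Atom)"
  proof (rule ptime_foldd)
    show "dsize (umax acc (dnth (tl_data e) (hd_data q))) \<le> dsize acc + dsize (tl_data e)" for e q acc
      using dsize_dnth_le[of "tl_data e" "hd_data q"] by (auto simp: umax_def)
    show "pbound (\<lambda>e. dsize (tl_data e))" by (intro ptime_pbound_dsize ptime_intros)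
  qed (intro ptime_intros)+
  have "ptime (\<lambda>e. rank_entry w d (hd_data e) (tl_data e))"
    unfolding rank_entry_def Let_def by (intro ptime_intros m ptime_comp[OF w])
  then have "ptime (\<lambda>e. rank_entry w d (hd_data e) (hd_data (tl_data e)))"
    by (rule ptime_comp2) (intro ptime_intros)+
  then have "ptime (\<lambda>x. dp (\<lambda>r v. rank_entry w d r v) (f x))"
    by (rule ptime_dp[where K = "2 * d + 3"]) (rule f dsize_rank_entry)+
  then show ?thesis unfolding rank_ok_def by (intro ptime_intros)
qed

text \<open>\<open>io_path\<close> with an arbitrary final gate, as needed for induction along the
  circuit.\<close>

definition path_to :: "circuit \<Rightarrow> nat \<Rightarrow> nat list \<Rightarrow> bool" where
  "path_to C i p \<longleftrightarrow> p \<noteq> [] \<and> hd p \<in> inputs C \<and> last p = i \<and>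
     successively (\<lambda>i j. j < length C \<and> i \<in> set (preds (C ! j))) p"

lemma io_path_iff: "io_path C p \<longleftrightarrow> path_to C (length C - 1) p"
  by (simp add: io_path_def path_to_def)

lemma path_to_cases:
  assumes "path_to C i p"
  obtains "p = [i]" "i \<in> inputs C"
    | q j where "p = q @ [i]" "path_to C j q" "j \<in> set (preds (C ! i))" "i < length C"
proof -
  from assms obtain q where p: "p = q @ [i]"
    by (metis append_butlast_last_id path_to_def)
  show ?thesis
  proof (cases "q = []")
    case True
    with assms p that(1) show ?thesis by (simp add: path_to_def)
  next
    case False
    with assms p show ?thesis
      by (intro that(2)[of q "last q"]) (auto simp: path_to_def successively_append_iff)
  qed
qed

lemma path_to_snoc:
  "path_to C j q \<Longrightarrow> j \<in> set (preds (C ! i)) \<Longrightarrow> i < length C \<Longrightarrow> path_to C i (q @ [i])"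
  by (auto simp: path_to_def successively_append_iff)

lemma foldd_umax:
  assumes "dlist l = map enc_nat js" "\<forall>j \<in> set js. dnth v (enc_nat j) = enc_nat (\<rho> j)"
  shows "foldd (\<lambda>q acc. umax acc (dnth v (hd_data q))) l (enc_nat a) =
    enc_nat (Max (insert a (\<rho> ` set js)))"
  using assms
proof (induction l arbitrary: js a)
  case Atom
  then show ?case by simp
next
  case (Pair y l)
  then obtain j js' where js: "js = j # js'" "y = enc_nat j" "dlist l = map enc_nat js'" by auto
  have "Max (insert (max a (\<rho> j)) (\<rho> ` set js')) = Max (insert a (\<rho> ` set js))"
    unfolding js(1) by (cases "js' = []") (auto simp: max.assoc)
  then show ?case using Pair.IH(2)[OF js(3), of "max a (\<rho> j)"] Pair.prems(2) js
    by (simp add: umax_enc_nat)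
qed

text \<open>Strong induction over the gates: each entry is the maximum of the capped weights of the
  paths to its gate. Weft is the case of large gates, depth the case of gates other than
  inputs.\<close>

lemma rank_ok_iff:
  assumes C: "is_circuit C" and w: "\<And>g. w (enc_gate g) \<longleftrightarrow> \<omega> g" and inp: "\<not> \<omega> InpG"
  shows "rank_ok w d (enc_circuit C) \<longleftrightarrow>
    (\<forall>p. io_path C p \<longrightarrow> length (filter (\<lambda>i. \<omega> (C ! i)) p) \<le> d)"
proof -
  define wt where "wt p = length (filter (\<lambda>i. \<omega> (C ! i)) p)" for p
  let ?x = "enc_circuit C"
  obtain V where V: "dlist (dp (rank_entry w d) ?x) = rev V" "length V = length C"
    "\<And>i. i < length C \<Longrightarrow>
       V ! i = rank_entry w d (enc_list (drop i (map enc_gate C))) (enc_list (take i V))"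
    by (rule dp_entries_circuit) (rule that)
  \<comment> \<open>\<open>\<rho>\<close> is the capped maximum: an upper bound that is attained by
    an actual path.\<close>
  define Good where "Good i \<rho> \<longleftrightarrow> V ! i = enc_nat \<rho> \<and> (\<forall>p. path_to C i p \<longrightarrow> min (Suc d) (wt p) \<le> \<rho>) \<and>
    (\<exists>p. path_to C i p \<and> min (Suc d) (wt p) = \<rho>)" for i \<rho>
  have good: "\<exists>\<rho>. Good i \<rho>" if "i < length C" for i
    using that
  proof (induction i rule: less_induct)
    case (less i)
    let ?js = "preds (C ! i)" and ?v = "enc_list (take i V)"
    have js: "j < i" if "j \<in> set ?js" for j using C that less.prems by (auto simp: is_circuit_def)
    have fan: "fan_in_ok (C ! i)" using C less.prems by (auto simp: is_circuit_def)
    have "\<forall>j. \<exists>\<rho>. j < i \<longrightarrow> Good j \<rho>" using less by (meson order_less_trans)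
    then obtain \<rho> where \<rho>: "\<And>j. j < i \<Longrightarrow> Good j (\<rho> j)" by metis
    define \<mu> where "\<mu> = Max (insert 0 (\<rho> ` set ?js))"
    have le_\<mu>: "\<rho> j \<le> \<mu>" if "j \<in> set ?js" for j unfolding \<mu>_def using that by (intro Max_ge) auto
    have nth: "dnth ?v (enc_nat j) = enc_nat (\<rho> j)" if "j \<in> set ?js" for j
      using js[OF that] \<rho>[of j] V(2) less.prems by (simp add: dnth_eq Good_def)
    have hd: "hd_data (enc_list (drop i (map enc_gate C))) = enc_gate (C ! i)"
      using less.prems by (simp add: hd_data_eq hd_drop_conv_nth)
    have fold: "foldd (\<lambda>q acc. umax acc (dnth ?v (hd_data q))) (dpreds (enc_gate (C ! i))) Atom = enc_nat \<mu>"
      using foldd_umax[of "dpreds (enc_gate (C ! i))" ?js ?v \<rho> 0] nth by (simp add: \<mu>_def)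
    define r where "r = (if \<mu> < Suc d then \<mu> + (if \<omega> (C ! i) then 1 else 0) else Suc d)"
    have uless: "uless (enc_nat \<mu>) (enc_nat (Suc d)) \<longleftrightarrow> \<mu> < Suc d"
      by (auto simp: uless_enc_nat simp del: enc_nat.simps)
    have Vi: "V ! i = enc_nat r"
      unfolding V(3)[OF less.prems] rank_entry_def hd fold Let_def w uless by (simp add: r_def)
    have upper: "min (Suc d) (wt p) \<le> r" if "path_to C i p" for p
      using that
    proof (cases rule: path_to_cases)
      case 1
      then show ?thesis using inp by (simp add: wt_def inputs_def)
    next
      case (2 q j)
      have "min (Suc d) (wt q) \<le> \<mu>"
        using \<rho>[OF js[OF 2(3)]] le_\<mu>[OF 2(3)] 2(2) unfolding Good_def by (meson order_trans)
      moreover have "wt p = wt q + (if \<omega> (C ! i) then 1 else 0)" by (simp add: wt_def 2(1))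
      ultimately show ?thesis by (auto simp: r_def)
    qed
    have "\<exists>p. path_to C i p \<and> min (Suc d) (wt p) = r"
    proof (cases "C ! i = InpG")
      case True
      then have "path_to C i [i]" using less.prems by (simp add: path_to_def inputs_def)
      moreover have "min (Suc d) (wt [i]) = r" using True inp by (simp add: wt_def r_def \<mu>_def)
      ultimately show ?thesis by blast
    next
      case False
      \<comment> \<open>The fan-in condition gives every other gate a predecessor, so the maximum
        comes from a path and not just from the 0 inserted in \<open>\<mu>\<close>.\<close>
      then have "?js \<noteq> []" using fan by (cases "C ! i") auto
      then have "Max (\<rho> ` set ?js) \<in> \<rho> ` set ?js" by (intro Max_in) auto
      moreover have "\<mu> = Max (\<rho> ` set ?js)" using \<open>?js \<noteq> []\<close> by (simp add: \<mu>_def)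
      ultimately obtain j where j: "j \<in> set ?js" "\<mu> = \<rho> j" by auto
      obtain q where q: "path_to C j q" "min (Suc d) (wt q) = \<mu>"
        using \<rho>[OF js[OF j(1)]] unfolding Good_def j(2) by blast
      have "wt (q @ [i]) = wt q + (if \<omega> (C ! i) then 1 else 0)" by (simp add: wt_def)
      then have "min (Suc d) (wt (q @ [i])) = r" using q(2) by (auto simp: r_def)
      with path_to_snoc[OF q(1) j(1) less.prems] show ?thesis by blast
    qed
    with Vi upper show ?case unfolding Good_def by blast
  qed
  have C0: "C \<noteq> []" using C by (simp add: is_circuit_def)
  then obtain \<rho> where \<rho>: "Good (length C - 1) \<rho>" using good[of "length C - 1"] by auto
  have "V \<noteq> []" using V(2) C0 by auto
  then have "hd_data (dp (rank_entry w d) ?x) = enc_nat \<rho>"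
    using hd_data_last_entry[OF V(1)] \<rho> V(2) by (simp add: Good_def)
  then have "rank_ok w d ?x \<longleftrightarrow> \<rho> \<le> d"
    unfolding rank_ok_def uless_enc_nat by auto
  also have "\<dots> \<longleftrightarrow> (\<forall>p. io_path C p \<longrightarrow> wt p \<le> d)"
  proof
    assume "\<rho> \<le> d"
    then show "\<forall>p. io_path C p \<longrightarrow> wt p \<le> d"
      using \<rho> unfolding Good_def io_path_iff by (metis min_def not_less_eq_eq order_trans)
  next
    assume "\<forall>p. io_path C p \<longrightarrow> wt p \<le> d"
    then show "\<rho> \<le> d"
      using \<rho> unfolding Good_def io_path_iff by (metis min.cobounded2 order_trans)
  qed
  finally show ?thesis by (simp add: wt_def)
qed

definition dlarge :: "data \<Rightarrow> bool" where
  "dlarge d \<longleftrightarrow> tl_data (tl_data (dpreds d)) \<noteq> Atom"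

lemma dlarge_enc_gate: "dlarge (enc_gate g) \<longleftrightarrow> large g"
  unfolding dlarge_def tl_data_neq_Atom large_def by auto

lemma weft_at_most_iff:
  "is_circuit C \<Longrightarrow> weft_at_most t C \<longleftrightarrow> rank_ok dlarge t (enc_circuit C)"
  by (subst rank_ok_iff[where \<omega> = large]) (auto simp: dlarge_enc_gate weft_at_most_def large_def)

lemma hd_enc_gate: "hd_data (enc_gate g) = enc_nat 0 \<longleftrightarrow> g = InpG"
  by (cases g) (auto simp del: enc_nat.simps)

text \<open>Every gate after the first has a predecessor, so only the first gate of a path is an
  input. This turns depth into a count of gates.\<close>

lemma path_to_length:
  "path_to C i p \<Longrightarrow> length p - 1 = length (filter (\<lambda>i. C ! i \<noteq> InpG) p)"
proof (induction p arbitrary: i rule: rev_induct)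
  case Nil
  then show ?case by simp
next
  case (snoc k p)
  from snoc.prems show ?case
  proof (cases rule: path_to_cases)
    case 1
    then show ?thesis by (simp add: inputs_def)
  next
    case (2 q j)
    then have "C ! i \<noteq> InpG" "k = i" "q = p" "p \<noteq> []" by (auto simp: path_to_def)
    moreover have "length p - 1 = length (filter (\<lambda>i. C ! i \<noteq> InpG) p)"
      using snoc.IH 2 \<open>q = p\<close> by blast
    ultimately show ?thesis by (cases p) auto
  qed
qed

lemma depth_at_most_iff:
  "is_circuit C \<Longrightarrow>
    depth_at_most d C \<longleftrightarrow> rank_ok (\<lambda>y. hd_data y \<noteq> enc_nat 0) d (enc_circuit C)"
  unfolding depth_at_most_def
  by (subst rank_ok_iff[where \<omega> = "\<lambda>g. g \<noteq> InpG"])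
    (simp_all add: hd_enc_gate del: enc_nat.simps, metis One_nat_def io_path_iff path_to_length)


subsection \<open>Evaluation\<close>

text \<open>The input gate at position \<open>i\<close> is set to true iff the tail of the circuit starting at this
  position is among the elements of \<open>S\<close>.\<close>

definition chosen :: "data \<Rightarrow> data \<Rightarrow> nat set" where
  "chosen x S = {i. i < length (dlist x) \<and> enc_list (drop i (dlist x)) \<in> set (dlist S)}"

definition val_entry :: "data \<Rightarrow> data \<Rightarrow> data \<Rightarrow> bool" where
  "val_entry S r v \<longleftrightarrow>
     (if hd_data (hd_data r) = enc_nat 0 then r \<in> set (dlist S)
      else if hd_data (hd_data r) = enc_nat 1 then dnth v (tl_data (hd_data r)) = Atom
      else if hd_data (hd_data r) = enc_nat 2
        then \<forall>q \<in> dtails (tl_data (hd_data r)). dnth v (hd_data q) \<noteq> Atom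
      else \<exists>q \<in> dtails (tl_data (hd_data r)). dnth v (hd_data q) \<noteq> Atom)"

definition dsat :: "data \<Rightarrow> data \<Rightarrow> bool" where
  "dsat x S \<longleftrightarrow> hd_data (dp (\<lambda>r v. data_of_bool (val_entry S r v)) x) \<noteq> Atom"

lemma ptime_bool_if:
  assumes "ptime (\<lambda>x. data_of_bool (P x))" "ptime (\<lambda>x. data_of_bool (Q x))"
    "ptime (\<lambda>x. data_of_bool (R x))"
  shows "ptime (\<lambda>x. data_of_bool (if P x then Q x else R x))"
proof -
  have "(\<lambda>x. data_of_bool (if P x then Q x else R x)) =
    (\<lambda>x. if P x then data_of_bool (Q x) else data_of_bool (R x))" by auto
  with ptime_if[OF assms] show ?thesis by simp
qed

lemma ptime_dsat [ptime_intros]: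
  assumes "ptime f" "ptime g"
  shows "ptime (\<lambda>x. data_of_bool (dsat (f x) (g x)))"
proof (rule ptime_comp2[where F = "\<lambda>x S. data_of_bool (dsat x S)", OF _ assms])
  have "ptime (\<lambda>e. data_of_bool (val_entry (tl_data (tl_data (tl_data e))) (hd_data e)
      (hd_data (tl_data e))))"
    unfolding val_entry_def by (intro ptime_intros ptime_bool_if)
  then have "ptime (\<lambda>e. dp (\<lambda>r v. data_of_bool (val_entry (tl_data e) r v)) (hd_data e))"
    by (rule ptime_dp[where K = 3]) (intro ptime_intros dsize_data_of_bool)+
  then show "ptime (\<lambda>e. data_of_bool (dsat (hd_data e) (tl_data e)))"
    unfolding dsat_def by (intro ptime_intros)
qed

lemma gate_vals_snoc:
  "gate_vals A (C @ [g]) = gate_vals A C @ [gate_val A (gate_vals A C) g]"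
  by (simp add: gate_vals_def)

lemma length_gate_vals [simp]: "length (gate_vals A C) = length C"
  by (induction C rule: rev_induct) (simp_all add: gate_vals_snoc, simp add: gate_vals_def)

lemma gate_vals_nth:
  "i < length C \<Longrightarrow> gate_vals A C ! i = gate_val A (take i (gate_vals A C)) (C ! i)"
  by (induction C rule: rev_induct) (auto simp: gate_vals_snoc nth_append less_Suc_eq)

lemma dsat_iff:
  assumes C: "is_circuit C"
  shows "dsat (enc_circuit C) S \<longleftrightarrow> satisfies (chosen (enc_circuit C) S) C"
proof -
  let ?x = "enc_circuit C" and ?A = "chosen (enc_circuit C) S"
  let ?G = "\<lambda>r v. data_of_bool (val_entry S r v)"
  let ?g = "gate_vals ?A C"
  obtain V where V: "dlist (dp ?G ?x) = rev V" "length V = length C"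
    "\<And>i. i < length C \<Longrightarrow>
       V ! i = ?G (enc_list (drop i (map enc_gate C))) (enc_list (take i V))"
    by (rule dp_entries_circuit) (rule that)
  have V_eq: "V ! i = data_of_bool (?g ! i)" if "i < length C" for i
    using that
  proof (induction i rule: less_induct)
    case (less i)
    let ?v = "enc_list (take i V)"
    have js: "j < i" if "j \<in> set (preds (C ! i))" for j
      using C that less.prems by (auto simp: is_circuit_def)
    have nth: "dnth ?v (enc_nat j) = data_of_bool (?g ! j)" if "j < i" for j
      using that less V(2) by (simp add: dnth_eq)
    have hd: "hd_data (enc_list (drop i (map enc_gate C))) = enc_gate (C ! i)"
      using less.prems by (simp add: hd_data_eq hd_drop_conv_nth)
    have "val_entry S (enc_list (drop i (map enc_gate C))) ?v \<longleftrightarrow> gate_val ?A (take i ?g) (C ! i)"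
    proof (cases "C ! i")
      case InpG
      then show ?thesis using less.prems by (simp add: val_entry_def hd chosen_def)
    next
      case (NotG j)
      then show ?thesis using js nth[of j] by (simp add: val_entry_def hd del: enc_nat.simps)
    next
      case (AndG js')
      then show ?thesis using js nth Ball_dtails_hd[of _ "\<lambda>y. dnth ?v y \<noteq> Atom"]
        by (simp add: val_entry_def hd del: enc_nat.simps)
    next
      case (OrG js')
      then show ?thesis using js nth Bex_dtails_hd[of _ "\<lambda>y. dnth ?v y \<noteq> Atom"]
        by (simp add: val_entry_def hd del: enc_nat.simps)
    qed
    then show ?case using V(3)[OF less.prems] gate_vals_nth[OF less.prems, of ?A] by simp
  qed
  have C0: "C \<noteq> []" using C by (simp add: is_circuit_def)
  then have "V \<noteq> []" "?g \<noteq> []" using V(2) length_gate_vals[of ?A C] by fastforce+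
  then have "hd_data (dp ?G ?x) = V ! (length C - 1)" "last ?g = ?g ! (length C - 1)"
    using hd_data_last_entry[OF V(1)] V(2) by (simp_all add: last_conv_nth)
  then show ?thesis using V_eq[of "length C - 1"] C0 by (simp add: dsat_def satisfies_def)
qed

text \<open>Counting positions of \<open>x\<close> rather than members of \<open>S\<close>
  disregards every segment that is not a suffix of \<open>x\<close>.\<close>

definition count_chosen :: "data \<Rightarrow> data \<Rightarrow> data" where
  "count_chosen x S = foldd (\<lambda>r acc. if r \<in> set (dlist S) then Pair Atom acc else acc) x Atom"

lemma ptime_count_chosen [ptime_intros]:
  assumes "ptime f" "ptime g"
  shows "ptime (\<lambda>x. count_chosen (f x) (g x))"
proof (rule ptime_comp2[OF _ assms])
  show "ptime (\<lambda>e. count_chosen (hd_data e) (tl_data e))"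
    unfolding count_chosen_def
    by (rule ptime_foldd'[where K = 2]; (intro ptime_intros)?; simp)
qed

lemma chosen_Pair: "chosen (Pair y x) S =
  (if Pair y x \<in> set (dlist S) then insert 0 (Suc ` chosen x S) else Suc ` chosen x S)"
proof -
  have "i \<in> chosen (Pair y x) S \<longleftrightarrow>
      i \<in> (if Pair y x \<in> set (dlist S) then insert 0 (Suc ` chosen x S) else Suc ` chosen x S)" for i
    by (cases i) (auto simp: chosen_def)
  then show ?thesis by blast
qed

lemma count_chosen_eq: "count_chosen x S = enc_nat (card (chosen x S))"
proof -
  have "foldd (\<lambda>r acc. if r \<in> set (dlist S) then Pair Atom acc else acc) x (enc_nat n) =
      enc_nat (n + card (chosen x S))" for n
  proof (induction x arbitrary: n)
    case Atom
    then show ?case by (simp add: chosen_def)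
  next
    case (Pair y x)
    have fin: "finite (chosen x S)" by (simp add: chosen_def)
    show ?case
      using Pair.IH(2)[of n] Pair.IH(2)[of "Suc n"] fin
      by (auto simp: chosen_Pair card_image simp flip: enc_nat.simps(2))
  qed
  from this[of 0] show ?thesis by (simp add: count_chosen_def)
qed

definition solution_ok :: "nat \<Rightarrow> nat \<Rightarrow> data \<Rightarrow> data \<Rightarrow> data \<Rightarrow> bool" where
  "solution_ok t d x k S \<longleftrightarrow> circuit_ok x \<and> rank_ok dlarge t x \<and>
     rank_ok (\<lambda>y. hd_data y \<noteq> enc_nat 0) d x \<and>
     (\<forall>r \<in> dtails x. r \<in> set (dlist S) \<longrightarrow> hd_data (hd_data r) = enc_nat 0) \<and>
     count_chosen x S = k \<and> dsat x S"

lemma ptime_solution_ok: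
  "ptime (\<lambda>e. data_of_bool (solution_ok t d (hd_data e) (hd_data (tl_data e)) (tl_data (tl_data e))))"
proof -
  have "ptime (\<lambda>y. data_of_bool (dlarge y))" unfolding dlarge_def by (intro ptime_intros)
  then show ?thesis
    unfolding solution_ok_def by (intro ptime_intros ptime_rank_ok)
qed

lemma solution_ok_iff:
  "solution_ok t d x (enc_nat k) S \<longleftrightarrow>
     (\<exists>C. x = enc_circuit C \<and> is_circuit C \<and> weft_at_most t C \<and> depth_at_most d C \<and>
       chosen x S \<subseteq> inputs C \<and> card (chosen x S) = k \<and> satisfies (chosen x S) C)"
proof -
  \<comment> \<open>A tail stands for the position at which it starts, and its head is the gate
    there.\<close>
  have "(\<forall>r \<in> dtails (enc_circuit C). r \<in> set (dlist S) \<longrightarrow> hd_data (hd_data r) = enc_nat 0) \<longleftrightarrow>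
      chosen (enc_circuit C) S \<subseteq> inputs C" for C
  proof -
    have "hd_data (hd_data (enc_list (drop i (map enc_gate C)))) = enc_nat 0 \<longleftrightarrow> C ! i = InpG"
      if "i < length C" for i
      using that by (simp add: hd_data_eq[of "enc_list _"] hd_drop_conv_nth hd_enc_gate del: enc_nat.simps)
    then show ?thesis by (auto simp: dtails_eq chosen_def inputs_def simp del: enc_nat.simps)
  qed
  then show ?thesis
    unfolding solution_ok_def circuit_ok_iff
    by (auto simp: weft_at_most_iff depth_at_most_iff dsat_iff count_chosen_eq simp del: enc_nat.simps)
qed


section \<open>The reduction\<close>

text \<open>Sound for every \<open>b\<close>: by determinism an accepting run is the run that
  computes \<open>\<Phi>\<close>. A sufficiently large bound is required only in the converse,
  \<open>criterion_ofI\<close>.\<close>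

lemma criterion_ofD:
  assumes "runs c N T (\<lambda>Z. data_of_bool (\<Phi> Z))" "criterion_of (c, b) S"
  shows "\<Phi> (enc_list (sorted_list_of_set (enc_list ` S)))"
proof -
  let ?Z = "enc_list (sorted_list_of_set (enc_list ` S))"
  obtain t y where "computes_in c ?Z t y" "y \<noteq> Atom" using assms(2) by (auto simp: criterion_of_def)
  moreover obtain u where "computes_in c ?Z u (data_of_bool (\<Phi> ?Z))"
    using runs_computes_in[OF assms(1)] by blast
  ultimately have "data_of_bool (\<Phi> ?Z) \<noteq> Atom"
    unfolding computes_in_init_store using exec_det by metis
  then show ?thesis by simp
qed

lemma criterion_ofI:
  assumes "runs c N T (\<lambda>Z. data_of_bool (\<Phi> Z))"
    "\<Phi> (enc_list (sorted_list_of_set (enc_list ` S)))"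
    "T (enc_list (sorted_list_of_set (enc_list ` S))) \<le> b"
  shows "criterion_of (c, b) S"
  unfolding criterion_of_def prod.case
  using runs_computes_in[OF assms(1), of "enc_list (sorted_list_of_set (enc_list ` S))"] assms(2,3)
  by (meson data_of_bool_eq_Atom(1) order_trans)

text \<open>A sequence of one state has only one segmentation, so its path visits a single inner
  node, whose label can only be \<open>\<phi>\<close>.\<close>

lemma has_flow_diagram_singleton_sequence:
  assumes "has_flow_diagram ([q] # \<T>) {\<phi>} l"
  obtains S where "finite S" "[q] \<in> S" "\<phi> S"
proof -
  let ?T = "[q] # \<T>"
  from assms obtain F where F: "is_flow_diagram {\<phi>} F" "valid_for ?T F"
    by (auto simp: has_flow_diagram_def)
  then obtain \<sigma> v where seg: "\<And>i. i < length ?T \<Longrightarrow>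
      segmentation (?T ! i) (\<sigma> i) \<and> length (v i) = length (\<sigma> i) \<and> st_path F (v i)"
    and lab: "\<And>u. u \<in> inner_nodes F \<Longrightarrow>
      label F u {\<sigma> i ! j | i j. i < length ?T \<and> j < length (\<sigma> i) \<and> v i ! j = u}"
    unfolding valid_for_def by blast
  have 0: "concat (\<sigma> 0) = [q]" "[] \<notin> set (\<sigma> 0)" using seg[of 0] by (auto simp: segmentation_def)
  have \<sigma>0: "\<sigma> 0 = [[q]]"
  proof (cases "\<sigma> 0")
    case Nil
    with 0 show ?thesis by simp
  next
    case (Cons s ss)
    with 0 have "s = [q]" "concat ss = []" by (auto simp: append_eq_Cons_conv)
    moreover have "ss = []" using calculation(2) 0(2) Cons by (cases ss) auto
    ultimately show ?thesis using Cons by simp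
  qed
  then obtain u where v0: "v 0 = [u]" using seg[of 0] by (auto simp: length_Suc_conv)
  then have "(source F, u) \<in> edges F" "(u, sink F) \<in> edges F"
    using seg[of 0] by (auto simp: st_path_def)
  \<comment> \<open>The source has no incoming and the sink no outgoing edge, so \<open>u\<close> is
    neither.\<close>
  then have u: "u \<in> inner_nodes F" using F(1) by (auto simp: is_flow_diagram_def inner_nodes_def)
  let ?S = "{\<sigma> i ! j | i j. i < length ?T \<and> j < length (\<sigma> i) \<and> v i ! j = u}"
  have "label F u = \<phi>" using F(1) u by (auto simp: is_flow_diagram_def)
  then have "\<phi> ?S" using lab[OF u] by simp
  moreover have "[q] \<in> ?S" using \<sigma>0 v0 by force
  \<comment> \<open>Finiteness matters because \<open>sorted_list_of_set\<close> of an infinite set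
    is empty, which would hide the control state from the program.\<close>
  moreover have "finite ?S"
  proof (rule finite_subset)
    show "?S \<subseteq> (\<Union>i < length ?T. set (\<sigma> i))" by auto
  qed simp
  ultimately show ?thesis using that by blast
qed

text \<open>The diagram with inner nodes 1 and 2: the suffixes and \<open>[q]\<close> visit node 2, the prefixes node 1.\<close>

lemma has_flow_diagram_suffixes:
  assumes a: "\<And>i. i < k \<Longrightarrow> a i < length gs"
    and suf: "\<phi> (insert [q] ((\<lambda>i. drop (a i) gs) ` {..<k}))"
    and pre: "\<phi> ((\<lambda>i. take (a i) gs) ` {i. i < k \<and> 0 < a i})"
  shows "has_flow_diagram ([q] # replicate k gs) {\<phi>} 4"
proof -
  let ?T = "[q] # replicate k gs"
  define F :: "'a flow_diagram" where "F = \<lparr>nodes = {0, 1, 2, 3}, edges = {(0, 1), (1, 2), (0, 2), (2, 3)},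
    source = 0, sink = 3, label = (\<lambda>_. \<phi>)\<rparr>"
  \<comment> \<open>Segments must be nonempty. A suffix is nonempty since \<open>a i\<close> is a
    position; a prefix of length 0 is dropped, and the path takes the edge from 0 to 2
    instead.\<close>
  define \<sigma> where "\<sigma> i = (case i of 0 \<Rightarrow> [[q]]
    | Suc i \<Rightarrow> if a i = 0 then [gs] else [take (a i) gs, drop (a i) gs])" for i
  define v where "v i = (case i of 0 \<Rightarrow> [2] | Suc i \<Rightarrow> if a i = 0 then [2] else [1, 2 :: nat])" for i
  have inner: "inner_nodes F = {1, 2}" by (auto simp: inner_nodes_def F_def)
  have "edges F \<subseteq> less_than" by (auto simp: F_def)
  then have "acyclic (edges F)" using wf_less_than wf_acyclic wf_subset by blast
  then have "is_flow_diagram {\<phi>} F" by (auto simp: is_flow_diagram_def F_def)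
  moreover have "segmentation (?T ! i) (\<sigma> i) \<and> length (v i) = length (\<sigma> i) \<and> st_path F (v i)"
    if "i < length ?T" for i
  proof (cases i)
    case 0
    then show ?thesis by (simp add: \<sigma>_def v_def segmentation_def st_path_def F_def)
  next
    case (Suc j)
    then have j: "j < k" using that by simp
    from a[OF j] Suc j show ?thesis
      by (auto simp: \<sigma>_def v_def segmentation_def st_path_def F_def)
  qed
  moreover have "label F u {\<sigma> i ! j | i j. i < length ?T \<and> j < length (\<sigma> i) \<and> v i ! j = u}"
    if "u \<in> inner_nodes F" for u
  proof -
    define at where "at i u = {s. \<exists>j < length (\<sigma> i). v i ! j = u \<and> s = \<sigma> i ! j}" for i u
    have at_0: "at 0 u = (if u = 2 then {[q]} else {})" for u
      by (auto simp: at_def \<sigma>_def v_def)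
    have at_1: "at (Suc i) 1 = (if 0 < a i then {take (a i) gs} else {})" for i
      by (auto simp: at_def \<sigma>_def v_def less_Suc_eq)
    have at_2: "at (Suc i) 2 = {drop (a i) gs}" for i
      by (auto simp: at_def \<sigma>_def v_def less_Suc_eq)
    have "{\<sigma> i ! j | i j. i < length ?T \<and> j < length (\<sigma> i) \<and> v i ! j = u} =
        (\<Union>i < Suc k. at i u)" by (auto simp: at_def)
    then have S: "{\<sigma> i ! j | i j. i < length ?T \<and> j < length (\<sigma> i) \<and> v i ! j = u} =
        at 0 u \<union> (\<Union>i < k. at (Suc i) u)"
      by (simp add: lessThan_Suc_eq_insert_0)
    have 1: "at 0 1 \<union> (\<Union>i < k. at (Suc i) 1) = (\<lambda>i. take (a i) gs) ` {i. i < k \<and> 0 < a i}"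
      unfolding at_0 at_1 by auto
    have 2: "at 0 2 \<union> (\<Union>i < k. at (Suc i) 2) = insert [q] ((\<lambda>i. drop (a i) gs) ` {..<k})"
      unfolding at_0 at_2 by auto
    have "label F u = \<phi>" by (simp add: F_def)
    moreover from that have "u = 1 \<or> u = 2" by (simp add: inner)
    ultimately show ?thesis unfolding S using suf pre 1 2 by metis
  qed
  ultimately have "is_flow_diagram {\<phi>} F" "valid_for ?T F" by (auto simp: valid_for_def)
  moreover have "card (nodes F) \<le> 4" by (simp add: F_def)
  ultimately show ?thesis by (auto simp: has_flow_diagram_def)
qed

lemma dsize_enc_list: "dsize (enc_list xs) = 1 + (\<Sum>x\<leftarrow>xs. Suc (dsize x))"
  by (induction xs) auto

lemma dsize_enc_list_le:
  assumes "\<And>x. x \<in> set xs \<Longrightarrow> dsize x \<le> M"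
  shows "dsize (enc_list xs) \<le> 1 + length xs * Suc M"
  using assms
proof (induction xs)
  case (Cons x xs)
  then have "dsize x \<le> M" "dsize (enc_list xs) \<le> 1 + length xs * Suc M" by auto
  then show ?case by simp
qed simp

lemma dsize_enc_list_take: "dsize (enc_list (take i xs)) \<le> dsize (enc_list xs)"
  using append_take_drop_id[of i xs] by (metis dsize_enc_list le_add1 map_append sum_list_append add.assoc)

lemma dsize_enc_list_drop: "dsize (enc_list (drop i xs)) \<le> dsize (enc_list xs)"
proof -
  have "dsize (enc_list xs) = 1 + ((\<Sum>x\<leftarrow>take i xs. Suc (dsize x)) + (\<Sum>x\<leftarrow>drop i xs. Suc (dsize x)))"
    using append_take_drop_id[of i xs] by (metis dsize_enc_list map_append sum_list_append)
  then show ?thesis by (simp add: dsize_enc_list)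
qed

text \<open>The first component cannot be the tag of a gate, which is a number.\<close>

definition control_tag :: data where
  "control_tag = Pair (Pair Atom Atom) Atom"

definition control_state :: "data \<Rightarrow> data \<Rightarrow> data" where
  "control_state x k = Pair control_tag (Pair x k)"

lemma hd_enc_gate_neq_control_tag: "hd_data (enc_gate g) \<noteq> control_tag"
proof -
  have "enc_nat n \<noteq> control_tag" for n by (cases n) (auto simp: control_tag_def)
  then show ?thesis by (cases g) (auto simp del: enc_nat.simps)
qed

definition sequences :: "data \<Rightarrow> nat \<Rightarrow> data list list" where
  "sequences x k = [control_state x (enc_nat k)] # replicate k (dlist x)"

text \<open>\<open>hd_data r\<close> is a segment, its head the first state, and the head of that
  the tag. The whole set \<open>Z\<close>, control segment included, is passed on as the set of
  suffixes.\<close>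

definition criterion_holds :: "nat \<Rightarrow> nat \<Rightarrow> data \<Rightarrow> bool" where
  "criterion_holds t d Z \<longleftrightarrow> (\<forall>r \<in> dtails Z. hd_data (hd_data (hd_data r)) = control_tag \<longrightarrow>
     solution_ok t d (hd_data (tl_data (hd_data (hd_data r)))) (tl_data (tl_data (hd_data (hd_data r)))) Z)"

lemma ptime_criterion_holds: "ptime (\<lambda>Z. data_of_bool (criterion_holds t d Z))"
  unfolding criterion_holds_def
  by (intro ptime_intros
      ptime_comp3[where F = "\<lambda>x y z. data_of_bool (solution_ok t d x y z)", OF ptime_solution_ok])

lemma criterion_holds_iff:
  "criterion_holds t d Z \<longleftrightarrow> (\<forall>y \<in> set (dlist Z). hd_data (hd_data y) = control_tag \<longrightarrow>
     solution_ok t d (hd_data (tl_data (hd_data y))) (tl_data (tl_data (hd_data y))) Z)"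
  by (simp add: criterion_holds_def set_dlist)

lemma WCS_iff:
  "(x, k) \<in> WCS t d \<longleftrightarrow> (\<exists>C A. x = enc_circuit C \<and> is_circuit C \<and> weft_at_most t C \<and>
     depth_at_most d C \<and> A \<subseteq> inputs C \<and> card A = k \<and> satisfies A C)"
  by (auto simp: WCS_def)

text \<open>One program serves all \<open>x\<close> and \<open>k\<close>: the instance travels in
  the control state, and only the time bound varies.\<close>

lemma WCS_as_flow_diagram:
  obtains c h where "ptime (\<lambda>z. enc_nat (h z))"
    "\<And>x k. (x, k) \<in> WCS t d \<longleftrightarrow>
       has_flow_diagram (sequences x k) {criterion_of (c, h (Pair x (enc_nat k)))} 4"
proof -
  obtain c N T where T: "pbound T" and c: "runs c N T (\<lambda>Z. data_of_bool (criterion_holds t d Z))"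
    using ptime_criterion_holds[of t d] by (auto simp: ptime_def)
  from T obtain K e where K: "\<And>x. T x \<le> K * dsize x ^ e" by (auto simp: pbound_def)
  \<comment> \<open>The intended sets have at most \<open>k + 1\<close> segments, hence at most
    \<open>dsize z\<close>. The control segment has encoded size exactly \<open>dsize z + 8\<close>:
    5 for the tag and 3 for the pairing nodes and the final \<open>Atom\<close>. Suffixes and
    prefixes of the circuit are no larger.\<close>
  define B where "B z = K * (1 + dsize z * Suc (dsize z + 8)) ^ e" for z
  have "pbound B" unfolding B_def Suc_eq_plus1 by (intro pbound_intros)
  then obtain h where h: "ptime (\<lambda>z. enc_nat (h z))" "\<And>z. B z \<le> h z"
    using pbound_ptime_enc_nat by metis
  have "(x, k) \<in> WCS t d \<longleftrightarrow>
      has_flow_diagram (sequences x k) {criterion_of (c, h (Pair x (enc_nat k)))} 4" for x k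
  proof
    let ?z = "Pair x (enc_nat k)" and ?q = "control_state x (enc_nat k)"
    assume "(x, k) \<in> WCS t d"
    then obtain C A where C: "x = enc_circuit C" "is_circuit C" "weft_at_most t C"
      "depth_at_most d C" and A: "A \<subseteq> inputs C" "card A = k" "satisfies A C"
      unfolding WCS_iff by blast
    have "finite A" using A(1) by (rule finite_subset) (simp add: inputs_def)
    \<comment> \<open>The \<open>i\<close>-th copy is split at \<open>a i\<close>, so each true
      input is selected by exactly one copy.\<close>
    then obtain a where "bij_betw a {..<k} A"
      using ex_bij_betw_nat_finite[of A] A(2) by (auto simp: atLeast0LessThan)
    then have aA: "a ` {..<k} = A" by (simp add: bij_betw_def)
    let ?gs = "map enc_gate C"
    have a: "a i < length ?gs" if "i < k" for i
      using that aA A(1) by (auto simp: inputs_def)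
    have time: "T (enc_list (sorted_list_of_set (enc_list ` S))) \<le> h ?z"
      if S: "finite S" "card S \<le> Suc k" "\<And>s. s \<in> S \<Longrightarrow> dsize (enc_list s) \<le> dsize ?z + 8" for S
    proof -
      let ?Z = "enc_list (sorted_list_of_set (enc_list ` S))"
      have "dsize ?Z \<le> 1 + card (enc_list ` S) * Suc (dsize ?z + 8)"
        using dsize_enc_list_le[of "sorted_list_of_set (enc_list ` S)" "dsize ?z + 8"] S(1,3) by auto
      also have "card (enc_list ` S) \<le> dsize ?z"
        using card_image_le[OF S(1), of enc_list] S(2) by simp
      finally have "dsize ?Z \<le> 1 + dsize ?z * Suc (dsize ?z + 8)" by simp
      then have "K * dsize ?Z ^ e \<le> B ?z" unfolding B_def by (intro mult_le_mono2 power_mono) auto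
      with K[of ?Z] h(2)[of ?z] show ?thesis by linarith
    qed
    have drops: "dsize (enc_list (drop i ?gs)) \<le> dsize ?z + 8"
      and takes: "dsize (enc_list (take i ?gs)) \<le> dsize ?z + 8" for i
      using dsize_enc_list_drop[of i ?gs] dsize_enc_list_take[of i ?gs]
      unfolding C(1) enc_circuit_def by simp_all
    have "has_flow_diagram ([?q] # replicate k ?gs) {criterion_of (c, h ?z)} 4"
    proof (rule has_flow_diagram_suffixes[where a = a])
      show "a i < length ?gs" if "i < k" for i using a[OF that] .
    next
      let ?S = "insert [?q] ((\<lambda>i. drop (a i) ?gs) ` {..<k})"
      let ?Z = "enc_list (sorted_list_of_set (enc_list ` ?S))"
      have Z: "set (dlist ?Z) = insert (Pair ?q Atom) ((\<lambda>i. enc_list (drop i ?gs)) ` A)"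
        unfolding dlist_enc_list by (subst set_sorted_list_of_set) (simp_all add: image_image flip: aA)
      show "criterion_of (c, h ?z) ?S"
      proof (rule criterion_ofI[OF c _ time])
        have "card ?S \<le> Suc (card ((\<lambda>i. drop (a i) ?gs) ` {..<k}))" by (rule card_insert_le_m1) auto
        also have "\<dots> \<le> Suc k" using card_image_le[of "{..<k}" "\<lambda>i. drop (a i) ?gs"] by simp
        finally show "card ?S \<le> Suc k" .
        show "dsize (enc_list s) \<le> dsize ?z + 8" if "s \<in> ?S" for s
          using that drops by (auto simp: control_state_def control_tag_def)
        have hd: "hd_data (enc_list (drop i ?gs)) = enc_gate (C ! i)" if "i < length C" for i
          using that by (simp add: hd_data_eq hd_drop_conv_nth)
        have A_less: "i < length C" if "i \<in> A" for i using that A(1) by (auto simp: inputs_def)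
        \<comment> \<open>Tails at different positions differ in length, and the control segment is
          no tail because its first state is not a gate.\<close>
        have chosen: "chosen x ?Z = A"
        proof -
          have "enc_list (drop i ?gs) \<in> set (dlist ?Z) \<longleftrightarrow> i \<in> A" if i: "i < length C" for i
          proof
            assume "enc_list (drop i ?gs) \<in> set (dlist ?Z)"
            then consider "enc_list (drop i ?gs) = Pair ?q Atom"
              | j where "j \<in> A" "drop i ?gs = drop j ?gs" unfolding Z by auto
            then show "i \<in> A"
            proof cases
              case 1
              then have "enc_gate (C ! i) = ?q" using hd[OF i] by simp
              then show ?thesis
                using hd_enc_gate_neq_control_tag[of "C ! i"] by (simp add: control_state_def)
            next
              case 2
              then have "length C - i = length C - j" by (metis length_drop length_map)
              then show ?thesis using i A_less[OF 2(1)] 2(1) by (metis diff_diff_cancel less_imp_le)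
            qed
          qed (unfold Z, blast)
          then show ?thesis using A_less by (auto simp: chosen_def C(1))
        qed
        have "solution_ok t d x (enc_nat k) ?Z"
          unfolding solution_ok_iff chosen using C A by blast
        \<comment> \<open>Suffixes begin with a gate, so only the control segment triggers the
          test.\<close>
        moreover have "y = Pair ?q Atom" if "y \<in> set (dlist ?Z)" "hd_data (hd_data y) = control_tag" for y
          using that hd A_less hd_enc_gate_neq_control_tag unfolding Z by auto
        ultimately show "criterion_holds t d ?Z"
          unfolding criterion_holds_iff by (metis control_state_def hd_data.simps(2) tl_data.simps(2))
      qed simp
    next
      let ?S = "(\<lambda>i. take (a i) ?gs) ` {i. i < k \<and> 0 < a i}"
      let ?Z = "enc_list (sorted_list_of_set (enc_list ` ?S))"
      have fin: "finite {i. i < k \<and> 0 < a i}" by simp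
      show "criterion_of (c, h ?z) ?S"
      proof (rule criterion_ofI[OF c _ time])
        have "card ?S \<le> card {i. i < k \<and> 0 < a i}" by (rule card_image_le[OF fin])
        also have "\<dots> \<le> card {..<k}" by (rule card_mono) auto
        finally show "card ?S \<le> Suc k" by simp
        show "dsize (enc_list s) \<le> dsize ?z + 8" if "s \<in> ?S" for s using that takes by auto
        \<comment> \<open>A nonempty prefix begins with the first gate of the circuit, so the
          criterion is vacuous at the prefix node.\<close>
        have "hd_data (hd_data y) \<noteq> control_tag" if y: "y \<in> set (dlist ?Z)" for y
        proof -
          from y obtain i where i: "i < k" "0 < a i" "y = enc_list (take (a i) ?gs)" using fin by auto
          then have "hd_data y = enc_gate (C ! 0)" using a[OF i(1)]
            by (cases C) (auto simp: take_Cons')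
          then show ?thesis using hd_enc_gate_neq_control_tag by simp
        qed
        then show "criterion_holds t d ?Z" unfolding criterion_holds_iff by blast
      qed (use fin in simp)
    qed
    then show "has_flow_diagram (sequences x k) {criterion_of (c, h ?z)} 4"
      by (simp add: sequences_def C(1))
  next
    let ?z = "Pair x (enc_nat k)" and ?q = "control_state x (enc_nat k)"
    assume "has_flow_diagram (sequences x k) {criterion_of (c, h ?z)} 4"
    then obtain S where S: "finite S" "[?q] \<in> S" "criterion_of (c, h ?z) S"
      unfolding sequences_def by (rule has_flow_diagram_singleton_sequence)
    let ?Z = "enc_list (sorted_list_of_set (enc_list ` S))"
    have "criterion_holds t d ?Z" using c S(3) by (rule criterion_ofD)
    moreover have "Pair ?q Atom \<in> set (dlist ?Z)" using S(1,2) by force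
    ultimately have "solution_ok t d x (enc_nat k) ?Z"
      unfolding criterion_holds_iff by (fastforce simp: control_state_def)
    then show "(x, k) \<in> WCS t d" unfolding solution_ok_iff WCS_iff by blast
  qed
  with h(1) show ?thesis using that by blast
qed

lemma FD_on_iff:
  "(enc_instance \<T> cs l, m) \<in> FD_on I \<longleftrightarrow>
     m = length \<T> \<and> (\<T>, cs, l) \<in> I \<and> has_flow_diagram \<T> (criterion_of ` set cs) l"
  by (auto simp: FD_on_def)

text \<open>Leaving the class \<open>I\<close> open covers both the unrestricted problem and the one
  with boundedly many criteria.\<close>

lemma fpt_reducible_FD_on:
  assumes P: "P \<le>\<^sub>f\<^sub>p\<^sub>t WCS t d" and I: "\<And>\<T> c b. (\<T>, [(c, b)], 4) \<in> I"
  shows "P \<le>\<^sub>f\<^sub>p\<^sub>t FD_on I"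
proof -
  obtain c h where h: "ptime (\<lambda>z. enc_nat (h z))" and iff: "\<And>x k. (x, k) \<in> WCS t d \<longleftrightarrow>
       has_flow_diagram (sequences x k) {criterion_of (c, h (Pair x (enc_nat k)))} 4"
    using WCS_as_flow_diagram[of t d] by metis
  \<comment> \<open>\<open>R\<close> assembles the encoded instance directly: \<open>x\<close> is
    already the encoding of \<open>dlist x\<close>, the fold over the unary parameter makes the
    copies, and the last \<open>Pair Atom\<close> increments the parameter.\<close>
  define R where "R z = Pair
    (Pair (Pair (Pair (control_state (hd_data z) (tl_data z)) Atom)
        (foldd (\<lambda>r acc. Pair (hd_data z) acc) (tl_data z) Atom))
      (Pair (Pair (Pair (enc_com c) (enc_nat (h z))) Atom) (enc_bin 4)))
    (Pair Atom (tl_data z))" for z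
  have "foldd (\<lambda>r acc. Pair x acc) (enc_nat k) (enc_list ys) = enc_list (replicate k x @ ys)" for x k ys
  proof (induction k arbitrary: ys)
    case (Suc k)
    from Suc[of "x # ys"] show ?case by (simp add: replicate_app_Cons_same)
  qed simp
  from this[of _ _ "[]"]
  have R_eq: "R (Pair x (enc_nat k)) =
      Pair (enc_instance (sequences x k) [(c, h (Pair x (enc_nat k)))] 4) (enc_nat (Suc k))" for x k
    by (simp add: R_def enc_instance_def sequences_def)
  have copies: "ptime (\<lambda>z. foldd (\<lambda>r acc. Pair (hd_data z) acc) (tl_data z) Atom)"
  proof (rule ptime_foldd[where B = "\<lambda>z. 1 + dsize (hd_data z)"])
    show "pbound (\<lambda>z. 1 + dsize (hd_data z))" by (intro pbound_intros ptime_pbound_dsize ptime_intros)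
  qed (intro ptime_intros | simp)+
  have "ptime R" unfolding R_def control_state_def by (intro ptime_intros h copies)
  from fpt_reducible_ptime[OF P this R_eq] show ?thesis
    using I iff by (simp add: FD_on_iff sequences_def)
qed

theorem theorem2: "W_hard 1 FD \<and> (\<exists>q. W_hard 1 (FD_criteria q))"
proof -
  have "P \<le>\<^sub>f\<^sub>p\<^sub>t FD" "P \<le>\<^sub>f\<^sub>p\<^sub>t FD_criteria 1" if "P \<in> W 1" for P
    using that unfolding W_def FD_def FD_criteria_def
    by (auto intro!: fpt_reducible_FD_on simp: FD_instances_def)
  then show ?thesis unfolding W_hard_def by blast
qed

end
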